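(* Let $G$ be a finite group, let $p$ be a prime, let $P$ be a Sylow $p$-subgroup of $G$, and fix an integer $e\ge 0$. Let $$\mathfrak{X}(P)=\{(H,\varphi)\in\Gamma_{p,e}(G)\mid H \text{ and } P \text{ are connected in } \mathcal{S}_{p,e}(G)\},$$ regarded as a subposet of $\Gamma_{p,e}(G)$. Then $$|\pi_0\Gamma_{p,e}(G)|=|\pi_0\mathfrak{X}(P)|\cdot|\pi_0\mathcal{S}_{p,e}(G)|\le |\pi_0\Gamma_{p,e}(P)|\cdot|\pi_0\mathcal{S}_{p,e}(G)|.$$ In particular, suppose that $P$ has a subgroup isomorphic to one of the following groups: (1) $C_{p^{e+1}}\times C_{p^{e+1}}$, where $C_{p^{e+1}}$ is the cyclic group of order $p^{e+1}$; or (2) an elementary abelian $p$-group of order $p^{e+2}$. Then $\Gamma_{p,e}(P)$ is connected and $|\pi_0\Gamma_{p,e}(G)|=|\pi_0\mathcal{S}_{p,e}(G)|=|G:\operatorname{Stab}_G([P])|$, where $\operatorname{Stab}_G([P])$ is the $G$-stabilizer of the connected component $[P]$ of $\mathcal{S}_{p,e}(G)$ containing $P$.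
   Context: For a finite group $G$, a prime $p$ and an integer $e\ge 0$: $\mathcal{S}_{p,e}(G)$ is the set of all $p$-subgroups of $G$ of order greater than $p^e$, partially ordered by inclusion. $\operatorname{Irr}(H)$ is the set of complex irreducible characters of $H$. $\Gamma_{p,e}(G)=\{(H,\varphi)\mid H\in\mathcal{S}_{p,e}(G),\ \varphi\in\operatorname{Irr}(H)\}$, partially ordered by: $(H,\varphi)\le(K,\psi)$ if $H\le K$ and $[\varphi,\psi_H]\ne 0$, where $\psi_H$ is the restriction of $\psi$ to $H$ and $[\cdot,\cdot]$ is the inner product of characters. In a poset $X$, two elements are connected (lie in the same connected component) if they can be joined by a finite sequence of elements of $X$ in which every two consecutive elements are comparable. $[x]$ is the connected component containing $x$, and $\pi_0X$ is the set of connected components of $X$. $X$ is connected if it has exactly one connected component. The group $G$ acts on $\pi_0\mathcal{S}_{p,e}(G)$ by $[H]^g=[H^g]$, where $H^g=g^{-1}Hg$. *)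

theory Defs
  imports
    "HOL-Algebra.Elementary_Groups"
    "Jordan_Normal_Form.VS_Connect"
begin

text \<open>A poset is given by its underlying set together with an order predicate; a subset is
  regarded as a subposet by keeping the predicate. Paths must stay inside the underlying set.\<close>

definition poset_conn :: "'b set \<Rightarrow> ('b \<Rightarrow> 'b \<Rightarrow> bool) \<Rightarrow> 'b \<Rightarrow> 'b \<Rightarrow> bool" where
  "poset_conn A R x y \<longleftrightarrow>
     x \<in> A \<and> (\<lambda>a b. a \<in> A \<and> b \<in> A \<and> (R a b \<or> R b a))\<^sup>*\<^sup>* x y"

definition poset_component :: "'b set \<Rightarrow> ('b \<Rightarrow> 'b \<Rightarrow> bool) \<Rightarrow> 'b \<Rightarrow> 'b set" where
  "poset_component A R x = {y. poset_conn A R x y}"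

definition pi0 :: "'b set \<Rightarrow> ('b \<Rightarrow> 'b \<Rightarrow> bool) \<Rightarrow> 'b set set" where
  "pi0 A R = poset_component A R ` A"

definition poset_connected :: "'b set \<Rightarrow> ('b \<Rightarrow> 'b \<Rightarrow> bool) \<Rightarrow> bool" where
  "poset_connected A R \<longleftrightarrow> (\<exists>!C. C \<in> pi0 A R)"

text \<open>A representation of degree \<open>n\<close> is a homomorphism into \<open>GL\<^sub>n(\<complex>)\<close>, the unit
  group of the ring of complex \<open>n \<times> n\<close> matrices.\<close>

definition is_repr :: "('a, 'm) monoid_scheme \<Rightarrow> nat \<Rightarrow> ('a \<Rightarrow> complex mat) \<Rightarrow> bool" where
  "is_repr G n \<rho> \<longleftrightarrow> \<rho> \<in> hom G (units_of (ring_mat TYPE(complex) n ()))"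

definition irr_repr :: "('a, 'm) monoid_scheme \<Rightarrow> nat \<Rightarrow> ('a \<Rightarrow> complex mat) \<Rightarrow> bool" where
  "irr_repr G n \<rho> \<longleftrightarrow> is_repr G n \<rho> \<and> n > 0 \<and>
     (\<forall>W. VectorSpace.subspace class_ring W (module_vec TYPE(complex) n) \<and>
          (\<forall>g\<in>carrier G. \<forall>w\<in>W. \<rho> g *\<^sub>v w \<in> W)
        \<longrightarrow> W = {0\<^sub>v n} \<or> W = carrier_vec n)"

definition mat_trace :: "complex mat \<Rightarrow> complex" where
  "mat_trace A = (\<Sum>i<dim_row A. A $$ (i, i))"

text \<open>Characters are extensional functions on the carrier, so that distinct elements of
  \<open>Irr G\<close> differ on \<open>carrier G\<close>.\<close>

definition character_of :: "('a, 'm) monoid_scheme \<Rightarrow> ('a \<Rightarrow> complex mat) \<Rightarrow> 'a \<Rightarrow> complex" where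
  "character_of G \<rho> = restrict (\<lambda>g. mat_trace (\<rho> g)) (carrier G)"

definition Irr :: "('a, 'm) monoid_scheme \<Rightarrow> ('a \<Rightarrow> complex) set" where
  "Irr G = {character_of G \<rho> | n \<rho>. irr_repr G n \<rho>}"

definition char_inner ::
  "('a, 'm) monoid_scheme \<Rightarrow> ('a \<Rightarrow> complex) \<Rightarrow> ('a \<Rightarrow> complex) \<Rightarrow> complex" where
  "char_inner G \<phi> \<psi> = (\<Sum>g\<in>carrier G. \<phi> g * cnj (\<psi> g)) / of_nat (card (carrier G))"

definition Spe :: "nat \<Rightarrow> nat \<Rightarrow> ('a, 'm) monoid_scheme \<Rightarrow> 'a set set" where
  "Spe p e G = {H. subgroup H G \<and> (\<exists>k. card H = p ^ k) \<and> card H > p ^ e}"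

definition Gamma_pe ::
  "nat \<Rightarrow> nat \<Rightarrow> ('a, 'm) monoid_scheme \<Rightarrow> ('a set \<times> ('a \<Rightarrow> complex)) set" where
  "Gamma_pe p e G = {(H, \<phi>). H \<in> Spe p e G \<and> \<phi> \<in> Irr (G\<lparr>carrier := H\<rparr>)}"

definition Gamma_le ::
  "('a, 'm) monoid_scheme \<Rightarrow> 'a set \<times> ('a \<Rightarrow> complex) \<Rightarrow> 'a set \<times> ('a \<Rightarrow> complex) \<Rightarrow> bool" where
  "Gamma_le G = (\<lambda>(H, \<phi>) (K, \<psi>).
     H \<subseteq> K \<and> char_inner (G\<lparr>carrier := H\<rparr>) \<phi> (restrict \<psi> H) \<noteq> 0)"

definition X_pe ::
  "nat \<Rightarrow> nat \<Rightarrow> ('a, 'm) monoid_scheme \<Rightarrow> 'a set \<Rightarrow> ('a set \<times> ('a \<Rightarrow> complex)) set" where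
  "X_pe p e G P = {(H, \<phi>) \<in> Gamma_pe p e G. poset_conn (Spe p e G) (\<subseteq>) H P}"

definition sylow_subgroup :: "nat \<Rightarrow> ('a, 'm) monoid_scheme \<Rightarrow> 'a set \<Rightarrow> bool" where
  "sylow_subgroup p G P \<longleftrightarrow> subgroup P G \<and> card P = p ^ multiplicity p (card (carrier G))"

definition conj_subgroup :: "('a, 'm) monoid_scheme \<Rightarrow> 'a set \<Rightarrow> 'a \<Rightarrow> 'a set" where
  "conj_subgroup G H g = (inv\<^bsub>G\<^esub> g <#\<^bsub>G\<^esub> H) #>\<^bsub>G\<^esub> g"

text \<open>Stabilizer of the component \<open>[P]\<close>, with the right action \<open>[H]\<^sup>g = [H\<^sup>g]\<close> on components unfolded.\<close>

definition comp_stabilizer :: "nat \<Rightarrow> nat \<Rightarrow> ('a, 'm) monoid_scheme \<Rightarrow> 'a set \<Rightarrow> 'a set" where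
  "comp_stabilizer p e G P =
     {g \<in> carrier G. poset_component (Spe p e G) (\<subseteq>) (conj_subgroup G P g)
                   = poset_component (Spe p e G) (\<subseteq>) P}"

definition elementary_abelian :: "nat \<Rightarrow> ('a, 'm) monoid_scheme \<Rightarrow> bool" where
  "elementary_abelian p G \<longleftrightarrow> comm_group G \<and> (\<forall>x\<in>carrier G. x [^]\<^bsub>G\<^esub> p = \<one>\<^bsub>G\<^esub>)"

end

(*
  Components of the character poset lie over components of the subgroup poset. By Sylow, every
  component of the latter contains a conjugate of P, and conjugation identifies the fibre over it
  with X(P); this gives the product formula and the index formula. Every (H, phi) in X(P) is joined
  to some (P, psi) along a path of subgroups from H to P, because a character of a subgroup can be
  extended upwards and restricted downwards with non-zero inner product; hence the inequality.

  For the last two facts no semisimplicity is needed. Splitting off invariant subspaces writes every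
  character as a sum of irreducible ones. If phi is irreducible, Schur's lemma makes
  (phi(1)/|H|) sum_h phi(h^-1) sigma(h) idempotent for every representation sigma, so inner products
  with phi are non-negative and cannot cancel. Restrictions then have irreducible constituents, and
  extensions are found among the finitely many constituents of the regular character, which also
  bounds the number of components.

  In the special cases, (P, psi) is joined to (Q, lambda) with Q abelian, and two characters of Q that
  agree on a subgroup of order greater than p^e are joined through it: through the kernel of lambda if
  Q is elementary abelian, and through the two factors if Q is a product of cyclic groups.
*)
theory Submission
  imports Defs
    "Jordan_Normal_Form.Schur_Decomposition"
    "Jordan_Normal_Form.Spectral_Radius"
    "Jordan_Normal_Form.DL_Rank"
    "HOL-Algebra.Multiplicative_Group"
    "HOL-Algebra.Group_Action"
begin

text \<open>Infinite sets have \<open>card\<close> 0, so each counting step must carry finiteness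
  along, while \<open>Irr\<close> itself is never shown to be finite. Representations are not
  assumed unitary although the inner product uses complex conjugation; the bridge chi(h^-1) = cnj
  chi(h) comes from triangular forms, whose diagonals consist of roots of unity. Triangular forms
  also replace diagonalization when traces of idempotents are computed. The constants in the special
  cases: a linear character of an elementary abelian group has a kernel of index at most p, so order
  p^(e+2) leaves a kernel of order at least p^(e+1), the least power of p above p^e. In a product of
  two cyclic groups each factor must itself pass that bound, hence p^(e+1) for each. If P is too
  small for the bound, then no p-subgroup passes it, all posets are empty, and the product formula
  reads 0 = 0.\<close>

section \<open>Linear algebra over the complex numbers\<close>

lemma subspace_vec_iff:
  "VectorSpace.subspace class_ring W (module_vec TYPE(complex) n) \<longleftrightarrow>
     W \<subseteq> carrier_vec n \<and> 0\<^sub>v n \<in> W \<and> (\<forall>v\<in>W. \<forall>w\<in>W. v + w \<in> W) \<and> (\<forall>c. \<forall>v\<in>W. c \<cdot>\<^sub>v v \<in> W)"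
proof -
  interpret vec_space "TYPE(complex)" n .
  show ?thesis
    unfolding VectorSpace.subspace_def submodule_def
    using vec_vs[of n] vec_module[of n]
    by (auto simp: module_vec_simps class_ring_simps)
qed

text \<open>A maximal independent subset of \<open>W\<close> is extended to a basis of the whole
  space, and the basis vectors become the columns of \<open>S\<close>, those from \<open>W\<close>
  first. In this basis every matrix that preserves \<open>W\<close> is block triangular.\<close>

lemma adapted_basis:
  assumes W: "VectorSpace.subspace class_ring W (module_vec TYPE(complex) n)"
  obtains S T k where "S \<in> carrier_mat n n" "T \<in> carrier_mat n n" "S * T = 1\<^sub>m n" "T * S = 1\<^sub>m n" "k \<le> n"
    "\<And>j. j < k \<Longrightarrow> col S j \<in> W"
    "\<And>w. w \<in> W \<Longrightarrow> \<exists>v\<in>carrier_vec n. w = S *\<^sub>v v \<and> (\<forall>i. k \<le> i \<longrightarrow> i < n \<longrightarrow> v $ i = 0)"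
proof -
  interpret vec_space "TYPE(complex)" n .
  have Wc: "W \<subseteq> carrier_vec n" using W by (simp add: subspace_vec_iff)
  have bound: "X \<subseteq> carrier_vec n \<Longrightarrow> lin_indpt X \<Longrightarrow> finite X \<and> card X \<le> n" for X
    using li_le_dim[of X] dim_is_n by auto
  have li0: "lin_indpt {}"
    unfolding lin_dep_def by auto
  \<comment> \<open>Independent sets have at most \<open>n\<close> elements, so a maximal one exists
    inside \<open>W\<close>, and likewise one above it in the full space.\<close>
  obtain B where B: "finite B" "maximal B (\<lambda>X. X \<subseteq> W \<and> lin_indpt X)"
    using maximal_exists[of "\<lambda>X. X \<subseteq> W \<and> lin_indpt X" n "{}"] bound Wc li0 by fastforce
  have BW: "B \<subseteq> W" "lin_indpt B" using B(2) by (auto simp: maximal_def)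
  obtain C where C: "finite C" "maximal C (\<lambda>X. B \<subseteq> X \<and> X \<subseteq> carrier_vec n \<and> lin_indpt X)"
    using maximal_exists[of "\<lambda>X. B \<subseteq> X \<and> X \<subseteq> carrier_vec n \<and> lin_indpt X" n B] bound
      order_trans[OF BW(1) Wc] BW(2) by blast
  have CC: "B \<subseteq> C" "C \<subseteq> carrier_vec n" "lin_indpt C" using C(2) by (auto simp: maximal_def)
  have "maximal C (\<lambda>X. X \<subseteq> carrier_vec n \<and> lin_indpt X)"
    using C(2) unfolding maximal_def by simp blast
  then have "basis C" by (rule max_li_is_basis)
  then have cardC: "card C = n" using dim_basis[OF C(1)] dim_is_n by simp
  have WB: "w \<in> span B" if w: "w \<in> W" for w
  proof (rule ccontr)
    assume n: "w \<notin> span B"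
    have wc: "w \<in> carrier_vec n" and Bc: "B \<subseteq> carrier_vec n" using w Wc BW by auto
    have "w \<notin> B" using n Bc in_own_span by auto
    then have "lin_indpt (insert w B)"
      using lin_dep_iff_in_span[OF Bc BW(2) wc] n by auto
    then have "insert w B = B" using B(2) w BW unfolding maximal_def by blast
    then show False using \<open>w \<notin> B\<close> by auto
  qed
  obtain bs where bs: "set bs = B" "distinct bs" using finite_distinct_list[OF B(1)] by auto
  obtain cs where cs: "set cs = C - B" "distinct cs" using finite_distinct_list[of "C - B"] C by auto
  define xs where "xs = bs @ cs"
  have xs: "set xs = C" "distinct xs" using bs cs CC by (auto simp: xs_def)
  then have len: "length xs = n" using cardC distinct_card by metis
  define S where "S = mat_of_cols n xs"
  have S: "S \<in> carrier_mat n n" using len by (auto simp: S_def)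
  have cols: "cols S = xs" unfolding S_def using xs CC by auto
  have "rank S = n" by (rule lin_indpt_full_rank[OF S]) (use cols xs CC in auto)
  then have "det S \<noteq> 0" using det_rank_iff[OF S] by auto
  from det_non_zero_imp_unit[OF S this, of "()"]
  obtain T where T: "T \<in> carrier_mat n n" "S * T = 1\<^sub>m n" "T * S = 1\<^sub>m n"
    unfolding Units_def ring_mat_simps by auto
  show thesis
  proof (rule that[OF S T, of "length bs"])
    show "length bs \<le> n" using len by (auto simp: xs_def)
    show "col S j \<in> W" if "j < length bs" for j
    proof -
      have "j < length xs" "xs ! j = bs ! j" using that by (auto simp: xs_def nth_append)
      then show ?thesis using that bs BW CC xs len unfolding S_def
        by (metis col_mat_of_cols nth_mem subsetD)
    qed
    fix w assume w: "w \<in> W"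
    have "w \<in> span_list bs" using WB[OF w] span_list_as_span[of bs] bs BW Wc by auto
    then obtain c where c: "w = lincomb_list c bs" by (auto elim: in_span_listE)
    \<comment> \<open>The coordinates of \<open>w\<close> with respect to \<open>bs\<close>, padded
      by zeros on the added basis vectors \<open>cs\<close>.\<close>
    define d where "d = (\<lambda>i. if i < length bs then c i else 0)"
    have "w = lincomb_list d xs"
    proof -
      have z: "sumlist (map (\<lambda>i. 0 \<cdot>\<^sub>v (f i)) is) = 0\<^sub>v n" if "\<forall>i\<in>set is. f i \<in> carrier_vec n" for f :: "nat \<Rightarrow> complex vec" and "is"
        using that by (induct "is") auto
      have 1: "map (\<lambda>i. d i \<cdot>\<^sub>v xs ! i) [0..<length xs] =
         map (\<lambda>i. c i \<cdot>\<^sub>v bs ! i) [0..<length bs] @ map (\<lambda>i. 0 \<cdot>\<^sub>v (cs ! (i - length bs))) [length bs..<length xs]"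
        by (rule nth_equalityI) (auto simp: d_def xs_def nth_append)
      have csn: "cs ! i \<in> carrier_vec n" if "i < length cs" for i
        using that cs CC nth_mem by blast
      have bsn: "bs ! i \<in> carrier_vec n" if "i < length bs" for i
        using that bs CC nth_mem by blast
      have "sumlist (map (\<lambda>i. 0 \<cdot>\<^sub>v (cs ! (i - length bs))) [length bs..<length xs]) = 0\<^sub>v n"
        by (rule z) (auto simp: xs_def intro!: csn)
      moreover have "sumlist (map (\<lambda>i. c i \<cdot>\<^sub>v bs ! i) [0..<length bs]) \<in> carrier_vec n"
        by (rule sumlist_carrier) (auto intro!: bsn)
      ultimately show ?thesis unfolding c lincomb_list_def 1
        by (subst sumlist_append) (auto simp: xs_def intro!: csn bsn)
    qed
    also have "\<dots> = S *\<^sub>v vec (length xs) d"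
      unfolding S_def by (rule lincomb_list_as_mat_mult) (use xs CC in auto)
    finally show "\<exists>v\<in>carrier_vec n. w = S *\<^sub>v v \<and> (\<forall>i. length bs \<le> i \<longrightarrow> i < n \<longrightarrow> v $ i = 0)"
      by (intro bexI[of _ "vec n d"]) (auto simp: len d_def)
  qed
qed

section \<open>Traces and triangular matrices\<close>

lemma mat_trace_mult_comm:
  assumes "A \<in> carrier_mat n m" "B \<in> carrier_mat m n"
  shows "mat_trace (A * B) = mat_trace (B * A)"
proof -
  have "mat_trace (A * B) = (\<Sum>i<n. \<Sum>j<m. A $$ (i,j) * B $$ (j,i))"
    using assms by (auto simp: mat_trace_def scalar_prod_def atLeast0LessThan intro!: sum.cong)
  also have "\<dots> = (\<Sum>j<m. \<Sum>i<n. B $$ (j,i) * A $$ (i,j))"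
    by (subst sum.swap) (simp add: mult.commute)
  also have "\<dots> = mat_trace (B * A)"
    using assms by (auto simp: mat_trace_def scalar_prod_def atLeast0LessThan intro!: sum.cong)
  finally show ?thesis .
qed

lemma mat_trace_conjugate:
  assumes "A \<in> carrier_mat n n" "S \<in> carrier_mat n n" "T \<in> carrier_mat n n" "S * T = 1\<^sub>m n"
  shows "mat_trace (T * A * S) = mat_trace A"
proof -
  have "mat_trace (T * A * S) = mat_trace (S * (T * A))"
    by (rule mat_trace_mult_comm[of _ n n]) (use assms in auto)
  also have "S * (T * A) = S * T * A" by (rule assoc_mult_mat[symmetric]) (use assms in auto)
  finally show ?thesis using assms by simp
qed

lemma mat_trace_four_block:
  assumes "A \<in> carrier_mat n n" "D \<in> carrier_mat m m"
  shows "mat_trace (four_block_mat A B C D) = mat_trace A + mat_trace D"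
proof -
  have "mat_trace (four_block_mat A B C D) = (\<Sum>i<n+m. if i < n then A $$ (i,i) else D $$ (i-n,i-n))"
    using assms by (auto simp: mat_trace_def intro!: sum.cong)
  also have "\<dots> = (\<Sum>i<n. A $$ (i,i)) + (\<Sum>i<m. D $$ (i,i))"
    by (induct m) auto
  finally show ?thesis using assms by (simp add: mat_trace_def)
qed

text \<open>Over the complex numbers the characteristic polynomial splits, so Schur decomposition
  applies. Triangular form suffices for every later use, since traces of powers only see the
  diagonal.\<close>

lemma triangularize:
  assumes "(A :: complex mat) \<in> carrier_mat n n"
  obtains B S T where "B \<in> carrier_mat n n" "upper_triangular B" "S \<in> carrier_mat n n" "T \<in> carrier_mat n n"
     "S * T = 1\<^sub>m n" "T * S = 1\<^sub>m n" "A = S * B * T"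
proof -
  obtain as where "char_poly A = (\<Prod>a\<leftarrow>as. [:- a, 1:])" using char_poly_factorized[OF assms] by auto
  then obtain B where B: "B \<in> carrier_mat n n" "upper_triangular B" "similar_mat A B"
    using schur_decomposition_exists[OF assms] by auto
  then obtain S T where "similar_mat_wit A B S T" unfolding similar_mat_def by auto
  from similar_mat_witD2[OF assms this] show thesis using that B by auto
qed

lemma upper_triangular_mult:
  assumes "A \<in> carrier_mat n n" "B \<in> carrier_mat n n" "upper_triangular A" "upper_triangular (B::complex mat)"
  shows "upper_triangular (A * B)" "i < n \<Longrightarrow> (A * B) $$ (i,i) = A $$ (i,i) * B $$ (i,i)"
proof -
  have e: "(A * B) $$ (i,j) = (\<Sum>k<n. A $$ (i,k) * B $$ (k,j))" if "i < n" "j < n" for i j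
    using assms that by (auto simp: scalar_prod_def atLeast0LessThan)
  have z: "A $$ (i,k) = 0" if "k < i" "i < n" for i k using assms that by auto
  have z': "B $$ (i,k) = 0" if "k < i" "i < n" for i k using assms that by auto
  show "upper_triangular (A * B)"
  proof
    fix i j assume ij: "i < dim_row (A * B)" "j < i"
    then have "i < n" "j < n" using assms by auto
    \<comment> \<open>Every summation index k satisfies k < i or k >= i > j, so one of the two
      factors lies below a diagonal.\<close>
    then show "(A * B) $$ (i, j) = 0" unfolding e[OF \<open>i < n\<close> \<open>j < n\<close>]
      by (intro sum.neutral ballI) (metis ij(2) lessThan_iff linorder_not_le mult_zero_left mult_zero_right order.strict_trans2 z z')
  qed
  assume i: "i < n"
  have "(A * B) $$ (i,i) = (\<Sum>k<n. if k = i then A $$ (i,i) * B $$ (i,i) else 0)"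
    unfolding e[OF i i]
    by (rule sum.cong) (use i z z' in \<open>auto simp: not_less_iff_gr_or_eq dest!: nat_neq_iff[THEN iffD1]\<close>)
  then show "(A * B) $$ (i,i) = A $$ (i,i) * B $$ (i,i)" using i by simp
qed

text \<open>In triangular form each diagonal entry b satisfies b * b = b, so it is 0 or 1, and the
  trace counts the ones.\<close>

lemma mat_trace_idempotent:
  assumes A: "(A :: complex mat) \<in> carrier_mat n n" and "A * A = A"
  obtains k :: nat where "mat_trace A = of_nat k"
proof -
  obtain B S T where *: "B \<in> carrier_mat n n" "upper_triangular B" "S \<in> carrier_mat n n" "T \<in> carrier_mat n n"
     "S * T = 1\<^sub>m n" "T * S = 1\<^sub>m n" "A = S * B * T" using triangularize[OF A] by metis
  have tr: "mat_trace A = mat_trace B" unfolding *(7)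
    by (rule mat_trace_conjugate) (use * in auto)
  have B: "B = T * A * S"
  proof -
    have "T * A * S = (T * S) * B * (T * S)" unfolding *(7) using *(1,3,4) by (simp add: assoc_mult_mat[of _ n n _ n _ n])
    then show ?thesis using *(1-6) by simp
  qed
  have "B * B = T * (A * ((S * T) * A)) * S" unfolding B using A *(3,4) by (simp add: assoc_mult_mat[of _ n n _ n _ n])
  also have "\<dots> = T * A * S" unfolding *(5) using A *(3,4) assms(2) by (simp)
  also note B[symmetric]
  finally have BB: "B * B = B" .
  have "B $$ (i,i) = (if B $$ (i,i) = 1 then 1 else 0)" if "i < n" for i
  proof -
    have "B $$ (i,i) = B $$ (i,i) * B $$ (i,i)" using upper_triangular_mult(2)[OF *(1,1,2,2) that] BB by simp
    then show ?thesis by auto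
  qed
  then have "mat_trace B = (\<Sum>i<n. if B $$ (i,i) = 1 then 1 else 0)"
    unfolding mat_trace_def using *(1) by (intro sum.cong) auto
  also have "\<dots> = of_nat (card {i\<in>{..<n}. B $$ (i,i) = 1})" by (subst sum.inter_filter[symmetric]) auto
  finally show thesis using that tr by auto
qed

section \<open>Schur's lemma\<close>

text \<open>Invertibility of the matrices comes for free: the image of \<open>inv x\<close> is a
  two-sided inverse of the image of \<open>x\<close>. This removes the unit group from all later
  arguments.\<close>

lemma is_repr_iff:
  fixes G (structure)
  assumes "group G"
  shows "is_repr G n \<rho> \<longleftrightarrow> (\<forall>x\<in>carrier G. \<rho> x \<in> carrier_mat n n) \<and>
     (\<forall>x\<in>carrier G. \<forall>y\<in>carrier G. \<rho> (x \<otimes> y) = \<rho> x * \<rho> y) \<and> \<rho> \<one> = 1\<^sub>m n"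
    (is "?l \<longleftrightarrow> ?r")
proof
  interpret group G by fact
  interpret R: ring "ring_mat TYPE(complex) n ()" by (rule ring_mat)
  interpret U: group "units_of (ring_mat TYPE(complex) n ())" by (rule R.units_group)
  {
    assume l: ?l
    then have h: "\<rho> \<in> hom G (units_of (ring_mat TYPE(complex) n ()))" by (simp add: is_repr_def)
    interpret group_hom G "units_of (ring_mat TYPE(complex) n ())" \<rho>
      by unfold_locales (rule h)
    have "\<rho> x \<in> Units (ring_mat TYPE(complex) n ())" if "x \<in> carrier G" for x
      using hom_closed[OF that] by (simp add: units_of_def)
    then have "\<rho> x \<in> carrier_mat n n" if "x \<in> carrier G" for x
      using R.Units_closed that by (simp add: ring_mat_simps)
    then show ?r using hom_one hom_mult by (simp add: units_of_def ring_mat_simps)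
  }
  {
    assume r: ?r
    have "\<rho> x \<in> Units (ring_mat TYPE(complex) n ())" if x: "x \<in> carrier G" for x
    proof -
      have "\<rho> x * \<rho> (inv x) = 1\<^sub>m n" "\<rho> (inv x) * \<rho> x = 1\<^sub>m n"
        using r x by (metis inv_closed r_inv) (use r x in \<open>metis inv_closed l_inv\<close>)
      then show ?thesis using r x unfolding Units_def ring_mat_simps by auto
    qed
    then show ?l using r unfolding is_repr_def
      by (intro homI) (auto simp: units_of_def ring_mat_simps)
  }
qed

lemma irr_repr_is_repr: "irr_repr G n \<rho> \<Longrightarrow> is_repr G n \<rho>"
  by (simp add: irr_repr_def)

text \<open>The size of a matrix is data rather than part of its type, so an empty sum has no
  canonical size; \<open>n\<close> fixes it, and the sum is taken entry by entry.\<close>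

definition mat_sum :: "nat \<Rightarrow> ('b \<Rightarrow> complex mat) \<Rightarrow> 'b set \<Rightarrow> complex mat" where
  "mat_sum n F X = mat n n (\<lambda>ij. \<Sum>x\<in>X. F x $$ ij)"

lemma mat_sum_carrier [simp]: "mat_sum n F X \<in> carrier_mat n n"
  by (simp add: mat_sum_def)

lemma mat_sum_cong: "X = Y \<Longrightarrow> (\<And>x. x \<in> Y \<Longrightarrow> F x = F' x) \<Longrightarrow> mat_sum n F X = mat_sum n F' Y"
  by (simp add: mat_sum_def)

lemma mat_sum_mult_left:
  assumes "A \<in> carrier_mat n n" "\<And>x. x \<in> X \<Longrightarrow> F x \<in> carrier_mat n n"
  shows "A * mat_sum n F X = mat_sum n (\<lambda>x. A * F x) X"
proof (rule eq_matI)
  fix i j assume "i < dim_row (mat_sum n (\<lambda>x. A * F x) X)" "j < dim_col (mat_sum n (\<lambda>x. A * F x) X)"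
  then have ij: "i < n" "j < n" by (auto simp: mat_sum_def)
  have "(A * mat_sum n F X) $$ (i, j) = (\<Sum>k\<in>{0..<n}. \<Sum>x\<in>X. A $$ (i,k) * F x $$ (k,j))"
    using ij assms(1) by (auto simp: mat_sum_def scalar_prod_def sum_distrib_left)
  also have "\<dots> = (\<Sum>x\<in>X. (A * F x) $$ (i,j))"
    by (subst sum.swap, rule sum.cong) (use ij assms in \<open>auto simp: scalar_prod_def carrier_matD[OF assms(2)]\<close>)
  finally show "(A * mat_sum n F X) $$ (i, j) = mat_sum n (\<lambda>x. A * F x) X $$ (i,j)"
    using ij by (simp add: mat_sum_def)
qed (use assms in \<open>auto simp: mat_sum_def\<close>)

lemma mat_sum_mult_right:
  assumes "A \<in> carrier_mat n n" "\<And>x. x \<in> X \<Longrightarrow> F x \<in> carrier_mat n n"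
  shows "mat_sum n F X * A = mat_sum n (\<lambda>x. F x * A) X"
proof (rule eq_matI)
  fix i j assume "i < dim_row (mat_sum n (\<lambda>x. F x * A) X)" "j < dim_col (mat_sum n (\<lambda>x. F x * A) X)"
  then have ij: "i < n" "j < n" by (auto simp: mat_sum_def)
  have "(mat_sum n F X * A) $$ (i, j) = (\<Sum>k\<in>{0..<n}. \<Sum>x\<in>X. F x $$ (i,k) * A $$ (k,j))"
    using ij assms(1) by (auto simp: mat_sum_def scalar_prod_def sum_distrib_right)
  also have "\<dots> = (\<Sum>x\<in>X. (F x * A) $$ (i,j))"
    by (subst sum.swap, rule sum.cong) (use ij assms in \<open>auto simp: scalar_prod_def carrier_matD[OF assms(2)]\<close>)
  finally show "(mat_sum n F X * A) $$ (i, j) = mat_sum n (\<lambda>x. F x * A) X $$ (i,j)"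
    using ij by (simp add: mat_sum_def)
qed (use assms in \<open>auto simp: mat_sum_def\<close>)

lemma mat_trace_mat_sum:
  assumes "\<And>x. x \<in> X \<Longrightarrow> F x \<in> carrier_mat n n"
  shows "mat_trace (mat_sum n F X) = (\<Sum>x\<in>X. mat_trace (F x))"
proof -
  have "mat_trace (mat_sum n F X) = (\<Sum>i<n. \<Sum>x\<in>X. F x $$ (i,i))"
    by (simp add: mat_trace_def mat_sum_def)
  also have "\<dots> = (\<Sum>x\<in>X. mat_trace (F x))"
    by (subst sum.swap, rule sum.cong) (auto simp: mat_trace_def carrier_matD[OF assms])
  finally show ?thesis .
qed

lemma mat_sum_reindex:
  "bij_betw f X Y \<Longrightarrow> mat_sum n F Y = mat_sum n (\<lambda>x. F (f x)) X"
  unfolding mat_sum_def by (subst sum.reindex_bij_betw[symmetric]) auto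

text \<open>A complex matrix has an eigenvalue, and the eigenspace is preserved by everything
  commuting with the matrix. Being non-zero and invariant, it is the whole space.\<close>

lemma schur_lemma:
  assumes "group G" "irr_repr G n \<rho>" and A: "A \<in> carrier_mat n n"
    and comm: "\<And>g. g \<in> carrier G \<Longrightarrow> A * \<rho> g = \<rho> g * A"
  obtains c where "A = c \<cdot>\<^sub>m 1\<^sub>m n"
proof -
  have n: "n > 0" and rep: "\<And>g. g \<in> carrier G \<Longrightarrow> \<rho> g \<in> carrier_mat n n"
    using assms(2) by (auto simp: irr_repr_def is_repr_iff[OF assms(1)])
  obtain c where "eigenvalue A c" using spectrum_non_empty[OF A n] by (auto simp: spectrum_def)
  then obtain v where v: "v \<in> carrier_vec n" "v \<noteq> 0\<^sub>v n" "A *\<^sub>v v = c \<cdot>\<^sub>v v"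
    using A by (auto simp: eigenvalue_def eigenvector_def)
  define W where "W = {w \<in> carrier_vec n. A *\<^sub>v w = c \<cdot>\<^sub>v w}"
  have "VectorSpace.subspace class_ring W (module_vec TYPE(complex) n)"
    using A by (auto simp: subspace_vec_iff W_def mult_add_distrib_mat_vec smult_add_distrib_vec
        mult_mat_vec smult_smult_assoc mult.commute)
  moreover have "\<rho> g *\<^sub>v w \<in> W" if g: "g \<in> carrier G" and w: "w \<in> W" for g w
  proof -
    have wc: "w \<in> carrier_vec n" "A *\<^sub>v w = c \<cdot>\<^sub>v w" using w by (auto simp: W_def)
    have "A *\<^sub>v (\<rho> g *\<^sub>v w) = \<rho> g *\<^sub>v (A *\<^sub>v w)"
      using comm[OF g] A rep[OF g] wc by (metis assoc_mult_mat_vec)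
    also have "\<dots> = c \<cdot>\<^sub>v (\<rho> g *\<^sub>v w)"
      unfolding wc(2) using mult_mat_vec[OF rep[OF g] wc(1)] by simp
    finally show ?thesis using rep[OF g] wc by (simp add: W_def)
  qed
  ultimately have "W = {0\<^sub>v n} \<or> W = carrier_vec n"
    using assms(2) by (auto simp: irr_repr_def)
  moreover have "v \<in> W" using v by (simp add: W_def)
  ultimately have W: "W = carrier_vec n" using v by auto
  have "A = c \<cdot>\<^sub>m 1\<^sub>m n"
  proof (rule eq_matI)
    fix i j assume "i < dim_row (c \<cdot>\<^sub>m 1\<^sub>m n)" "j < dim_col (c \<cdot>\<^sub>m 1\<^sub>m n)"
    then have ij: "i < n" "j < n" by auto
    have "unit_vec n j \<in> W" using W by simp
    then have "(A *\<^sub>v unit_vec n j) $ i = (c \<cdot>\<^sub>v unit_vec n j) $ i" by (simp add: W_def)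
    then show "A $$ (i,j) = (c \<cdot>\<^sub>m 1\<^sub>m n) $$ (i,j)"
      using ij A by (auto simp: scalar_prod_right_unit)
  qed (use A in auto)
  then show thesis by (rule that)
qed

text \<open>Averaging the matrix unit \<open>M\<close> over the group by conjugation gives a matrix
  commuting with the representation, hence a scalar by Schur's lemma; comparing traces determines
  the scalar. The sum in question is the (i,j) entry of this average.\<close>

lemma schur_orthogonality:
  fixes G (structure)
  assumes G: "group G" "finite (carrier G)" and irr: "irr_repr G n \<rho>"
    and ijkl: "i < n" "j < n" "k < n" "l < n"
  shows "(\<Sum>h\<in>carrier G. \<rho> (inv h) $$ (i,k) * \<rho> h $$ (l,j))
       = (if k = l \<and> i = j then of_nat (card (carrier G)) / of_nat n else 0)"
proof -
  interpret group G by fact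
  have rep: "\<And>g. g \<in> carrier G \<Longrightarrow> \<rho> g \<in> carrier_mat n n"
     "\<And>x y. x \<in> carrier G \<Longrightarrow> y \<in> carrier G \<Longrightarrow> \<rho> (x \<otimes> y) = \<rho> x * \<rho> y" "\<rho> \<one> = 1\<^sub>m n" and n: "n > 0"
    using irr by (auto simp: irr_repr_def is_repr_iff[OF G(1)])
  \<comment> \<open>The matrix unit with its 1 in position (k,l): between two matrices it picks
    column k of the left one and row l of the right one.\<close>
  define M where "M = mat n n (\<lambda>(a,b). if a = k \<and> b = l then 1 else 0 :: complex)"
  have M: "M \<in> carrier_mat n n" by (simp add: M_def)
  define F where "F = (\<lambda>h. \<rho> (inv h) * (M * \<rho> h))"
  have Fc: "F h \<in> carrier_mat n n" if "h \<in> carrier G" for h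
    unfolding F_def using that M rep(1) by (metis inv_closed mult_carrier_mat)
  define A where "A = mat_sum n F (carrier G)"
  have A: "A \<in> carrier_mat n n" by (simp add: A_def)
  have "A * \<rho> g = \<rho> g * A" if g: "g \<in> carrier G" for g
  proof -
    \<comment> \<open>The substitution of \<open>h \<otimes> g\<close> for \<open>h\<close> moves
      the matrix of \<open>g\<close> from the left of the average to its right.\<close>
    have bij: "bij_betw (\<lambda>h. h \<otimes> g) (carrier G) (carrier G)"
      by (rule bij_betwI[of _ _ _ "\<lambda>h. h \<otimes> inv g"]) (use g in \<open>auto simp: m_assoc\<close>)
    have "\<rho> g * A = mat_sum n (\<lambda>h. \<rho> g * F h) (carrier G)"
      unfolding A_def by (rule mat_sum_mult_left) (use rep g Fc in auto)
    also have "\<dots> = mat_sum n (\<lambda>h. \<rho> g * F (h \<otimes> g)) (carrier G)"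
      by (rule mat_sum_reindex[OF bij])
    also have "\<dots> = mat_sum n (\<lambda>h. F h * \<rho> g) (carrier G)"
    proof (rule mat_sum_cong)
      fix h assume h: "h \<in> carrier G"
      have r4: "\<rho> g \<in> carrier_mat n n" "\<rho> h \<in> carrier_mat n n" "\<rho> (inv g) \<in> carrier_mat n n" "\<rho> (inv h) \<in> carrier_mat n n"
        using rep(1) h g by auto
      have "\<rho> g * F (h \<otimes> g) = \<rho> g * \<rho> (inv g \<otimes> inv h) * (M * \<rho> (h \<otimes> g))"
        unfolding F_def using h g r4 rep(2) M by (simp add: inv_mult_group assoc_mult_mat[of _ n n _ n _ n])
      also have "\<rho> g * \<rho> (inv g \<otimes> inv h) = \<rho> (inv h)"
        using h g by (simp flip: rep(2) add: m_assoc[symmetric])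
      also have "\<rho> (inv h) * (M * \<rho> (h \<otimes> g)) = F h * \<rho> g"
        unfolding F_def using h g r4 rep(2) M by (simp add: assoc_mult_mat[of _ n n _ n _ n])
      finally show "\<rho> g * F (h \<otimes> g) = F h * \<rho> g" .
    qed simp
    also have "\<dots> = A * \<rho> g"
      unfolding A_def by (rule mat_sum_mult_right[symmetric]) (use rep g Fc in auto)
    finally show ?thesis by simp
  qed
  then obtain c where c: "A = c \<cdot>\<^sub>m 1\<^sub>m n" using schur_lemma[OF G(1) irr A] by metis
  have trM: "mat_trace M = (if k = l then 1 else 0)"
  proof -
    have "mat_trace M = (\<Sum>a<n. if a = k then (if k = l then 1 else 0) else 0)"
      unfolding mat_trace_def by (rule sum.cong) (auto simp: M_def)
    then show ?thesis using ijkl by simp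
  qed
  have "mat_trace (F h) = mat_trace M" if h: "h \<in> carrier G" for h
  proof -
    have "F h = \<rho> (inv h) * M * \<rho> h" unfolding F_def using h rep M by (simp add: assoc_mult_mat[of _ n n _ n _ n])
    then show ?thesis using mat_trace_conjugate[OF M, of "\<rho> h" "\<rho> (inv h)"] h rep(1,3) rep(2)[of h "inv h"] by simp
  qed
  then have "mat_trace A = of_nat (card (carrier G)) * (if k = l then 1 else 0)"
    unfolding A_def using mat_trace_mat_sum[of "carrier G" F n] Fc trM by simp
  moreover have "mat_trace A = of_nat n * c" by (simp add: c mat_trace_def)
  ultimately have c': "c = (if k = l then of_nat (card (carrier G)) / of_nat n else 0)"
    using n by (auto simp: field_simps)
  have "F h $$ (i,j) = \<rho> (inv h) $$ (i,k) * \<rho> h $$ (l,j)" if h: "h \<in> carrier G" for h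
  proof -
    have r: "\<rho> h \<in> carrier_mat n n" "\<rho> (inv h) \<in> carrier_mat n n" using rep h by auto
    have 1: "(M * \<rho> h) $$ (a,j) = (if a = k then \<rho> h $$ (l,j) else 0)" if a: "a < n" for a
    proof -
      have "(M * \<rho> h) $$ (a,j) = (\<Sum>b\<in>{0..<n}. M $$ (a,b) * \<rho> h $$ (b,j))"
        using a r M ijkl by (simp add: scalar_prod_def)
      also have "\<dots> = (\<Sum>b\<in>{0..<n}. if b = l then (if a = k then \<rho> h $$ (l,j) else 0) else 0)"
        by (rule sum.cong) (use a in \<open>auto simp: M_def\<close>)
      finally have "(M * \<rho> h) $$ (a,j) = (\<Sum>b\<in>{0..<n}. if b = l then (if a = k then \<rho> h $$ (l,j) else 0) else 0)" .
      then show ?thesis using ijkl by simp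
    qed
    have "F h $$ (i,j) = (\<Sum>a\<in>{0..<n}. \<rho> (inv h) $$ (i,a) * (M * \<rho> h) $$ (a,j))"
      using r M ijkl unfolding F_def by (simp add: scalar_prod_def)
    also have "\<dots> = (\<Sum>a\<in>{0..<n}. if a = k then \<rho> (inv h) $$ (i,k) * \<rho> h $$ (l,j) else 0)"
      by (rule sum.cong) (auto simp: 1 simp del: index_mult_mat)
    finally show ?thesis using ijkl by simp
  qed
  then have "(\<Sum>h\<in>carrier G. \<rho> (inv h) $$ (i,k) * \<rho> h $$ (l,j)) = A $$ (i,j)"
    using ijkl by (simp add: A_def mat_sum_def)
  also have "\<dots> = (if k = l \<and> i = j then of_nat (card (carrier G)) / of_nat n else 0)"
    using ijkl by (simp add: c c')
  finally show ?thesis .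
qed

lemma mat_trace_mult_sum:
  assumes "A \<in> carrier_mat n n" "B \<in> carrier_mat n n"
  shows "mat_trace (A * B) = (\<Sum>k<n. \<Sum>i<n. A $$ (k,i) * B $$ (i,k))"
  using assms by (auto simp: mat_trace_def scalar_prod_def atLeast0LessThan intro!: sum.cong)

text \<open>An irreducible character reproduces itself under convolution up to the factor |G|/n. At
  the identity this gives norm 1, and in general it gives the idempotent used for non-negativity;
  orthogonality of different irreducible characters is never invoked.\<close>

lemma irr_trace_convolution:
  fixes G (structure)
  assumes G: "group G" "finite (carrier G)" and irr: "irr_repr G n \<rho>" and g: "g \<in> carrier G"
  shows "(\<Sum>h\<in>carrier G. mat_trace (\<rho> (g \<otimes> inv h)) * mat_trace (\<rho> h))
       = of_nat (card (carrier G)) / of_nat n * mat_trace (\<rho> g)"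
proof -
  interpret group G by fact
  have rep: "\<And>g. g \<in> carrier G \<Longrightarrow> \<rho> g \<in> carrier_mat n n"
     "\<And>x y. x \<in> carrier G \<Longrightarrow> y \<in> carrier G \<Longrightarrow> \<rho> (x \<otimes> y) = \<rho> x * \<rho> y" and n: "n > 0"
    using irr by (auto simp: irr_repr_def is_repr_iff[OF G(1)])
  let ?c = "of_nat (card (carrier G)) / of_nat n :: complex"
  have "mat_trace (\<rho> (g \<otimes> inv h)) * mat_trace (\<rho> h) =
     (\<Sum>k<n. \<Sum>i<n. \<Sum>j<n. \<rho> g $$ (k,i) * (\<rho> (inv h) $$ (i,k) * \<rho> h $$ (j,j)))" if h: "h \<in> carrier G" for h
  proof -
    have "mat_trace (\<rho> (g \<otimes> inv h)) = (\<Sum>k<n. \<Sum>i<n. \<rho> g $$ (k,i) * \<rho> (inv h) $$ (i,k))"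
      using rep g h by (simp add: mat_trace_mult_sum[of _ n])
    moreover have "mat_trace (\<rho> h) = (\<Sum>j<n. \<rho> h $$ (j,j))"
      using rep h by (auto simp: mat_trace_def)
    ultimately show ?thesis by (simp only: sum_distrib_right) (simp only: sum_distrib_left mult.assoc)
  qed
  then have "(\<Sum>h\<in>carrier G. mat_trace (\<rho> (g \<otimes> inv h)) * mat_trace (\<rho> h)) =
     (\<Sum>h\<in>carrier G. \<Sum>k<n. \<Sum>i<n. \<Sum>j<n. \<rho> g $$ (k,i) * (\<rho> (inv h) $$ (i,k) * \<rho> h $$ (j,j)))"
    by simp
  also have "\<dots> = (\<Sum>k<n. \<Sum>i<n. \<Sum>j<n. \<Sum>h\<in>carrier G. \<rho> g $$ (k,i) * (\<rho> (inv h) $$ (i,k) * \<rho> h $$ (j,j)))"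
    by (subst sum.swap, rule sum.cong[OF refl], subst sum.swap, rule sum.cong[OF refl], subst sum.swap, rule refl)
  \<comment> \<open>Orthogonality leaves only the terms with i = j = k.\<close>
  also have "\<dots> = (\<Sum>k<n. \<Sum>i<n. \<Sum>j<n. if j = k then (if i = k then ?c * \<rho> g $$ (k,i) else 0) else 0)"
    by (intro sum.cong refl, subst sum_distrib_left[symmetric], subst schur_orthogonality[OF G irr]) auto
  also have "\<dots> = (\<Sum>k<n. ?c * \<rho> g $$ (k,k))"
    by (intro sum.cong refl) (simp)
  also have "\<dots> = ?c * mat_trace (\<rho> g)"
    using rep g by (auto simp: mat_trace_def sum_distrib_left)
  finally show ?thesis .
qed

text \<open>The diagonal entries b of a triangular form satisfy b^(N+1) = 1. Hence they have modulus
  1, and b^N is the inverse of b, which is its conjugate.\<close>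

lemma mat_trace_power_pred:
  assumes A: "(A :: complex mat) \<in> carrier_mat n n" and "A ^\<^sub>m Suc N = 1\<^sub>m n"
  shows "mat_trace (A ^\<^sub>m N) = cnj (mat_trace A)"
proof -
  obtain B S T where *: "B \<in> carrier_mat n n" "upper_triangular B" "S \<in> carrier_mat n n" "T \<in> carrier_mat n n"
     "S * T = 1\<^sub>m n" "T * S = 1\<^sub>m n" "A = S * B * T" using triangularize[OF A] by metis
  have pow: "A ^\<^sub>m k = S * (B ^\<^sub>m k) * T" for k
    by (rule similar_mat_wit_pow_id) (use A * in \<open>auto simp: similar_mat_wit_def Let_def\<close>)
  have tr: "mat_trace (A ^\<^sub>m k) = mat_trace (B ^\<^sub>m k)" for k unfolding pow
    by (rule mat_trace_conjugate) (use * in auto)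
  have up: "upper_triangular (B ^\<^sub>m k) \<and> (\<forall>i<n. (B ^\<^sub>m k) $$ (i,i) = (B $$ (i,i)) ^ k)" for k
  proof (induct k)
    case 0 show ?case using *(1) by auto
  next
    case (Suc k)
    then show ?case using upper_triangular_mult[of "B ^\<^sub>m k" n B] *(1,2) by (auto simp del: index_mult_mat)
  qed
  have "B ^\<^sub>m Suc N = T * (A ^\<^sub>m Suc N) * S"
  proof -
    have "T * (A ^\<^sub>m Suc N) * S = (T * S) * B ^\<^sub>m Suc N * (T * S)"
      unfolding pow using *(3,4) pow_carrier_mat[OF *(1), of "Suc N"]
      by (simp add: assoc_mult_mat[of _ n n _ n _ n] del: pow_mat.simps)
    then show ?thesis using *(1,6) by (simp del: pow_mat.simps)
  qed
  then have B1: "B ^\<^sub>m Suc N = 1\<^sub>m n" unfolding assms(2) using * by simp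
  have "(B $$ (i,i)) ^ N = cnj (B $$ (i,i))" if "i < n" for i
  proof -
    let ?b = "B $$ (i,i)"
    have b: "?b ^ Suc N = 1" using up[of "Suc N"] that unfolding B1 by auto
    then have "norm ?b ^ Suc N = 1" by (metis norm_power norm_one)
    then have "norm ?b = 1" using power_eq_imp_eq_base[of "norm ?b" "Suc N" 1] by simp
    then have "?b * cnj ?b = 1" by (simp add: complex_norm_square[symmetric])
    moreover have "?b * ?b ^ N = 1" using b by simp
    ultimately show ?thesis by (metis mult_cancel_left mult_zero_left zero_neq_one)
  qed
  then show ?thesis
    using tr[of N] up[of N] tr[of 1] *(1) by (simp add: mat_trace_def)
qed

lemma repr_pow:
  fixes G (structure)
  assumes "group G" "is_repr G n \<rho>" "x \<in> carrier G"
  shows "\<rho> (x [^] (k::nat)) = \<rho> x ^\<^sub>m k"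
proof -
  interpret group G by fact
  show ?thesis using assms by (induct k) (auto simp: is_repr_iff[OF assms(1)])
qed

lemma repr_trace_inv:
  fixes G (structure)
  assumes G: "group G" "finite (carrier G)" and rep: "is_repr G n \<rho>" and x: "x \<in> carrier G"
  shows "mat_trace (\<rho> (inv x)) = cnj (mat_trace (\<rho> x))"
proof -
  interpret group G by fact
  have "Coset.order G > 0" using G by (simp add: order_gt_0_iff_finite)
  \<comment> \<open>With N + 1 the order of the group, the inverse of \<open>x\<close> is the power
    \<open>x [^] N\<close>, uniformly in \<open>x\<close>.\<close>
  then obtain N where N: "Coset.order G = Suc N" by (cases "Coset.order G") auto
  have e: "x [^] Suc N = \<one>" using pow_order_eq_1[OF x] N by simp
  then have "x [^] N \<otimes> x = \<one>" by simp
  then have "inv x = x [^] N" using x inv_equality by auto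
  then show ?thesis
    using mat_trace_power_pred[of "\<rho> x" n N] repr_pow[OF G(1) rep x] e rep x
    by (metis is_repr_iff[OF G(1)])
qed

section \<open>Inner products and decomposition of characters\<close>

text \<open>Trading conjugation for inversion makes the expression polynomial in matrix entries, the
  form in which Schur orthogonality applies. Inverting the summation variable puts the inverse on
  \<open>\<rho>\<close> instead of \<open>\<sigma>\<close>.\<close>

lemma char_inner_repr:
  fixes G (structure)
  assumes G: "group G" "finite (carrier G)" and rep: "is_repr G m \<sigma>"
  shows "char_inner G (character_of G \<rho>) (character_of G \<sigma>)
    = (\<Sum>h\<in>carrier G. mat_trace (\<rho> (inv h)) * mat_trace (\<sigma> h)) / of_nat (card (carrier G))"
proof -
  interpret group G by fact
  have bij: "bij_betw (\<lambda>h. inv h) (carrier G) (carrier G)"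
    by (rule bij_betwI[of _ _ _ "\<lambda>h. inv h"]) auto
  have "(\<Sum>g\<in>carrier G. character_of G \<rho> g * cnj (character_of G \<sigma> g))
     = (\<Sum>g\<in>carrier G. mat_trace (\<rho> g) * mat_trace (\<sigma> (inv g)))"
    by (rule sum.cong) (auto simp: character_of_def repr_trace_inv[OF G rep])
  also have "\<dots> = (\<Sum>h\<in>carrier G. mat_trace (\<rho> (inv h)) * mat_trace (\<sigma> h))"
    by (subst sum.reindex_bij_betw[OF bij, symmetric]) auto
  finally show ?thesis by (simp add: char_inner_def)
qed

lemma char_inner_irr_self:
  fixes G (structure)
  assumes G: "group G" "finite (carrier G)" and irr: "irr_repr G n \<rho>"
  shows "char_inner G (character_of G \<rho>) (character_of G \<rho>) = 1"
proof -
  interpret group G by fact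
  have n: "n > 0" and rep: "is_repr G n \<rho>" using irr by (auto simp: irr_repr_def)
  have c: "card (carrier G) \<noteq> 0" using G by auto
  have "(\<Sum>h\<in>carrier G. mat_trace (\<rho> (inv h)) * mat_trace (\<rho> h)) = of_nat (card (carrier G)) / of_nat n * mat_trace (\<rho> \<one>)"
    using irr_trace_convolution[OF G irr one_closed] by simp
  also have "mat_trace (\<rho> \<one>) = of_nat n"
    using rep by (simp add: is_repr_iff[OF G(1)] mat_trace_def)
  finally show ?thesis using n c by (simp add: char_inner_repr[OF G rep])
qed

lemma smult_mult_smult_mat:
  assumes "A \<in> carrier_mat n m" "B \<in> carrier_mat m l"
  shows "(a \<cdot>\<^sub>m A) * (b \<cdot>\<^sub>m B) = (a * b :: complex) \<cdot>\<^sub>m (A * B)"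
  by (rule eq_matI) (use assms in \<open>auto simp: scalar_prod_def sum_distrib_left mult_ac\<close>)

text \<open>The matrix \<open>n / |G| \<Sum>\<^sub>h \<phi>(h\<inverse>) \<sigma>(h)\<close> is idempotent, so its trace, which is
  \<open>n\<close> times the inner product, is a natural number.\<close>

lemma char_inner_irr_nonneg:
  fixes G (structure)
  assumes G: "group G" "finite (carrier G)" and irr: "irr_repr G n \<rho>" and rep: "is_repr G m \<sigma>"
  obtains r where "r \<ge> (0::real)" "char_inner G (character_of G \<rho>) (character_of G \<sigma>) = of_real r"
proof -
  interpret group G by fact
  have n: "n > 0" using irr by (auto simp: irr_repr_def)
  have sc: "\<And>g. g \<in> carrier G \<Longrightarrow> \<sigma> g \<in> carrier_mat m m"
     and sm: "\<And>x y. x \<in> carrier G \<Longrightarrow> y \<in> carrier G \<Longrightarrow> \<sigma> (x \<otimes> y) = \<sigma> x * \<sigma> y"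
    using rep by (auto simp: is_repr_iff[OF G(1)])
  define N where "N = (of_nat (card (carrier G)) :: complex)"
  have N: "N \<noteq> 0" using G by (auto simp: N_def)
  define a where "a = (\<lambda>h. of_nat n / N * mat_trace (\<rho> (inv h)))"
  define E where "E = mat_sum m (\<lambda>h. a h \<cdot>\<^sub>m \<sigma> h) (carrier G)"
  have E: "E \<in> carrier_mat m m" by (simp add: E_def)
  \<comment> \<open>The coefficient function is idempotent under convolution: the square of n/|G|
    meets the factor |G|/n from \<open>irr_trace_convolution\<close>.\<close>
  have conv: "(\<Sum>h\<in>carrier G. a h * a (inv h \<otimes> g)) = a g" if g: "g \<in> carrier G" for g
  proof -
    have bij: "bij_betw (\<lambda>h. inv h) (carrier G) (carrier G)"
      by (rule bij_betwI[of _ _ _ "\<lambda>h. inv h"]) auto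
    have "(\<Sum>h\<in>carrier G. a h * a (inv h \<otimes> g)) = (\<Sum>h\<in>carrier G. a (inv h) * a (h \<otimes> g))"
      by (subst sum.reindex_bij_betw[OF bij, symmetric]) auto
    also have "\<dots> = (\<Sum>h\<in>carrier G. (of_nat n / N)\<^sup>2 * (mat_trace (\<rho> (inv g \<otimes> inv h)) * mat_trace (\<rho> h)))"
      by (rule sum.cong) (use g in \<open>auto simp: a_def inv_mult_group power2_eq_square mult_ac\<close>)
    also have "\<dots> = (of_nat n / N)\<^sup>2 * (N / of_nat n * mat_trace (\<rho> (inv g)))"
      unfolding sum_distrib_left[symmetric] using irr_trace_convolution[OF G irr, of "inv g"] g by (simp add: N_def)
    also have "\<dots> = a g" using n N by (simp add: a_def power2_eq_square)
    finally show ?thesis .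
  qed
  have "E * E = E"
  proof (rule eq_matI)
    fix i j assume "i < dim_row E" "j < dim_col E"
    then have ij: "i < m" "j < m" using E by auto
    have "(E * E) $$ (i,j) = (mat_sum m (\<lambda>h. (a h \<cdot>\<^sub>m \<sigma> h) * E) (carrier G)) $$ (i,j)"
      by (subst E_def, subst mat_sum_mult_right[OF E]) (use sc in auto)
    also have "\<dots> = (\<Sum>h\<in>carrier G. ((a h \<cdot>\<^sub>m \<sigma> h) * E) $$ (i,j))"
      using ij by (simp add: mat_sum_def)
    also have "\<dots> = (\<Sum>h\<in>carrier G. \<Sum>g\<in>carrier G. a h * a (inv h \<otimes> g) * \<sigma> g $$ (i,j))"
    proof (rule sum.cong[OF refl])
      fix h assume h: "h \<in> carrier G"
      \<comment> \<open>For fixed \<open>h\<close>, the second copy of \<open>E\<close> is summed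
        over \<open>inv h \<otimes> g\<close>, so that the product of the two matrices becomes the
        matrix of \<open>g\<close>.\<close>
      have bij: "bij_betw (\<lambda>g. inv h \<otimes> g) (carrier G) (carrier G)"
        by (rule bij_betwI[of _ _ _ "\<lambda>g. h \<otimes> g"]) (use h in \<open>auto simp: m_assoc[symmetric]\<close>)
      have "E = mat_sum m (\<lambda>g. a (inv h \<otimes> g) \<cdot>\<^sub>m \<sigma> (inv h \<otimes> g)) (carrier G)"
        unfolding E_def by (rule mat_sum_reindex[OF bij])
      then have "(a h \<cdot>\<^sub>m \<sigma> h) * E = mat_sum m (\<lambda>g. (a h \<cdot>\<^sub>m \<sigma> h) * (a (inv h \<otimes> g) \<cdot>\<^sub>m \<sigma> (inv h \<otimes> g))) (carrier G)"
        using mat_sum_mult_left[of "a h \<cdot>\<^sub>m \<sigma> h" m "carrier G" "\<lambda>g. a (inv h \<otimes> g) \<cdot>\<^sub>m \<sigma> (inv h \<otimes> g)"] sc h by auto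
      also have "\<dots> = mat_sum m (\<lambda>g. (a h * a (inv h \<otimes> g)) \<cdot>\<^sub>m \<sigma> g) (carrier G)"
      proof (rule mat_sum_cong[OF refl])
        fix g assume g: "g \<in> carrier G"
        have "(a h \<cdot>\<^sub>m \<sigma> h) * (a (inv h \<otimes> g) \<cdot>\<^sub>m \<sigma> (inv h \<otimes> g)) = (a h * a (inv h \<otimes> g)) \<cdot>\<^sub>m (\<sigma> h * \<sigma> (inv h \<otimes> g))"
          using sc[OF h] sc[of "inv h \<otimes> g"] g h
          by (intro smult_mult_smult_mat) auto
        also have "\<sigma> h * \<sigma> (inv h \<otimes> g) = \<sigma> g" using g h by (simp flip: sm add: m_assoc[symmetric])
        finally show "(a h \<cdot>\<^sub>m \<sigma> h) * (a (inv h \<otimes> g) \<cdot>\<^sub>m \<sigma> (inv h \<otimes> g)) = (a h * a (inv h \<otimes> g)) \<cdot>\<^sub>m \<sigma> g" .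
      qed
      finally show "((a h \<cdot>\<^sub>m \<sigma> h) * E) $$ (i,j) = (\<Sum>g\<in>carrier G. a h * a (inv h \<otimes> g) * \<sigma> g $$ (i,j))"
        using ij by (simp add: mat_sum_def carrier_matD[OF sc])
    qed
    also have "\<dots> = (\<Sum>g\<in>carrier G. a g * \<sigma> g $$ (i,j))"
      by (subst sum.swap) (auto simp: conv sum_distrib_right[symmetric])
    also have "\<dots> = E $$ (i,j)" using ij by (simp add: E_def mat_sum_def carrier_matD[OF sc])
    finally show "(E * E) $$ (i,j) = E $$ (i,j)" .
  qed (use E in auto)
  then obtain k :: nat where k: "mat_trace E = of_nat k" using mat_trace_idempotent[OF E] by metis
  have tr: "mat_trace (c \<cdot>\<^sub>m A) = c * mat_trace A" if "A \<in> carrier_mat m m" for c A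
    using that by (simp add: mat_trace_def sum_distrib_left)
  have "mat_trace E = (\<Sum>h\<in>carrier G. a h * mat_trace (\<sigma> h))"
    unfolding E_def by (subst mat_trace_mat_sum) (use sc in \<open>auto simp: tr\<close>)
  also have "\<dots> = of_nat n * char_inner G (character_of G \<rho>) (character_of G \<sigma>)"
    by (simp add: char_inner_repr[OF G rep] a_def N_def sum_distrib_left sum_divide_distrib mult_ac)
  \<comment> \<open>The trace of the idempotent is a natural number k, so the inner product is
    k/n.\<close>
  finally have "char_inner G (character_of G \<rho>) (character_of G \<sigma>) = of_real (real k / real n)"
    using n k by (simp add: field_simps)
  then show thesis by (intro that[of "real k / real n"]) auto
qed

lemma char_inner_Irr_nonneg:
  assumes "group G" "finite (carrier G)" "\<phi> \<in> Irr G" "\<chi> \<in> Irr G"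
  obtains r where "r \<ge> (0::real)" "char_inner G \<phi> \<chi> = of_real r"
  using assms char_inner_irr_nonneg[OF assms(1,2)] unfolding Irr_def by (smt (verit) irr_repr_is_repr mem_Collect_eq)

lemma char_inner_Irr_self:
  assumes "group G" "finite (carrier G)" "\<phi> \<in> Irr G"
  shows "char_inner G \<phi> \<phi> = 1"
  using assms char_inner_irr_self[OF assms(1,2)] unfolding Irr_def by auto

lemma split_block_zero:
  fixes A :: "complex mat"
  assumes A: "A \<in> carrier_mat n n" and k: "k \<le> n"
    and z: "\<And>i j. k \<le> i \<Longrightarrow> i < n \<Longrightarrow> j < k \<Longrightarrow> A $$ (i,j) = 0"
    and "split_block A k k = (A1, A2, A3, A4)"
  shows "A1 \<in> carrier_mat k k" "A2 \<in> carrier_mat k (n-k)" "A4 \<in> carrier_mat (n-k) (n-k)"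
    "A = four_block_mat A1 A2 (0\<^sub>m (n-k) k) A4"
proof -
  have A': "A \<in> carrier_mat (k + (n-k)) (k + (n-k))" using A k by simp
  have dims: "dim_row A = k + (n-k)" "dim_col A = k + (n-k)" using A k by auto
  note sb = split_block[OF assms(4) dims]
  show "A1 \<in> carrier_mat k k" "A2 \<in> carrier_mat k (n-k)" "A4 \<in> carrier_mat (n-k) (n-k)" using sb by auto
  have "A3 = 0\<^sub>m (n-k) k"
  proof (rule eq_matI)
    fix i j assume "i < dim_row (0\<^sub>m (n-k) k)" "j < dim_col (0\<^sub>m (n-k) k)"
    then show "A3 $$ (i,j) = 0\<^sub>m (n-k) k $$ (i,j)"
      using z[of "i+k" j] A assms(4) by (auto simp: split_block_def Let_def)
  qed (use sb in auto)
  then show "A = four_block_mat A1 A2 (0\<^sub>m (n-k) k) A4" using sb by simp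
qed

text \<open>In a basis adapted to \<open>W\<close> the matrices are block upper triangular, and the
  diagonal blocks are the actions on \<open>W\<close> and on the quotient by \<open>W\<close>. No
  invariant complement is needed: the block above the diagonal does not contribute to the
  trace.\<close>

lemma invariant_subspace_split:
  fixes G (structure)
  assumes G: "group G" and rep: "is_repr G n \<sigma>" and W: "VectorSpace.subspace class_ring W (module_vec TYPE(complex) n)"
    and inv: "\<And>g w. g \<in> carrier G \<Longrightarrow> w \<in> W \<Longrightarrow> \<sigma> g *\<^sub>v w \<in> W"
    and W0: "W \<noteq> {0\<^sub>v n}" and W1: "W \<noteq> carrier_vec n"
  obtains k \<sigma>1 \<sigma>2 where "0 < k" "k < n" "is_repr G k \<sigma>1" "is_repr G (n - k) \<sigma>2"
    "\<And>g. g \<in> carrier G \<Longrightarrow> mat_trace (\<sigma> g) = mat_trace (\<sigma>1 g) + mat_trace (\<sigma>2 g)"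
proof -
  interpret group G by fact
  have rp: "\<And>g. g \<in> carrier G \<Longrightarrow> \<sigma> g \<in> carrier_mat n n"
     "\<And>x y. x \<in> carrier G \<Longrightarrow> y \<in> carrier G \<Longrightarrow> \<sigma> (x \<otimes> y) = \<sigma> x * \<sigma> y" "\<sigma> \<one> = 1\<^sub>m n"
    using rep by (auto simp: is_repr_iff[OF G(1)])
  have Ws: "W \<subseteq> carrier_vec n" "0\<^sub>v n \<in> W" "\<And>v w. v \<in> W \<Longrightarrow> w \<in> W \<Longrightarrow> v + w \<in> W" "\<And>c v. v \<in> W \<Longrightarrow> c \<cdot>\<^sub>v v \<in> W"
    using W by (auto simp: subspace_vec_iff)
  obtain S T k where ST: "S \<in> carrier_mat n n" "T \<in> carrier_mat n n" "S * T = 1\<^sub>m n" "T * S = 1\<^sub>m n" "k \<le> n"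
    and cols: "\<And>j. j < k \<Longrightarrow> col S j \<in> W"
    and coord: "\<And>w. w \<in> W \<Longrightarrow> \<exists>v\<in>carrier_vec n. w = S *\<^sub>v v \<and> (\<forall>i. k \<le> i \<longrightarrow> i < n \<longrightarrow> v $ i = 0)"
    using adapted_basis[OF W] by metis
  \<comment> \<open>If k were 0, all coordinates of vectors of \<open>W\<close> would vanish; if k
    were n, all columns of \<open>S\<close>, hence all vectors, would lie in \<open>W\<close>. Both
    are excluded.\<close>
  have k0: "k \<noteq> 0"
  proof
    assume k: "k = 0"
    have "w = 0\<^sub>v n" if w: "w \<in> W" for w
    proof -
      obtain v where v: "v \<in> carrier_vec n" "w = S *\<^sub>v v" "\<forall>i<n. v $ i = 0" using coord[OF w] k by auto
      have "v = 0\<^sub>v n" by (rule eq_vecI) (use v in auto)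
      moreover have "S *\<^sub>v 0\<^sub>v n = 0\<^sub>v n" using ST by (intro eq_vecI) auto
      ultimately show ?thesis using v by simp
    qed
    then show False using W0 Ws(2) by blast
  qed
  have kn: "k \<noteq> n"
  proof
    assume k: "k = n"
    have "w \<in> W" if w: "w \<in> carrier_vec n" for w
    proof -
      interpret vec_space "TYPE(complex)" n .
      have "submodule class_ring W V" using W by (simp add: VectorSpace.subspace_def)
      moreover have "set (cols S) \<subseteq> W"
        using cols k ST by (auto simp: cols_def)
      ultimately have sp: "span (set (cols S)) \<subseteq> W" by (intro span_is_subset) auto
      have cs: "set (cols S) \<subseteq> carrier_vec n" using ST cols_dim by blast
      have "w = S *\<^sub>v (T *\<^sub>v w)" using ST w by (simp flip: assoc_mult_mat_vec)
      also have "\<dots> = lincomb_list (\<lambda>i. (T *\<^sub>v w) $ i) (cols S)"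
      proof -
        have "vec n (\<lambda>i. (T *\<^sub>v w) $ i) = T *\<^sub>v w" using ST by (intro eq_vecI) auto
        moreover have "\<forall>u\<in>set (cols S). dim_vec u = n" using cs by auto
        moreover have "mat_of_cols n (cols S) = S" "length (cols S) = n" using ST by auto
        ultimately show ?thesis
          using lincomb_list_as_mat_mult[of "cols S" "\<lambda>i. (T *\<^sub>v w) $ i"] by simp
      qed
      finally have "w \<in> span_list (cols S)" by (auto intro: in_span_listI)
      then show ?thesis using span_list_as_span[OF cs] sp by auto
    qed
    then show False using W1 Ws(1) by blast
  qed
  define \<tau> where "\<tau> = (\<lambda>g. T * \<sigma> g * S)"
  have tc: "\<tau> g \<in> carrier_mat n n" if "g \<in> carrier G" for g using rp(1)[OF that] ST by (simp add: \<tau>_def)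
  have tm: "\<tau> (x \<otimes> y) = \<tau> x * \<tau> y" if xy: "x \<in> carrier G" "y \<in> carrier G" for x y
  proof -
    have c: "\<sigma> x \<in> carrier_mat n n" "\<sigma> y \<in> carrier_mat n n" using rp xy by auto
    have "\<tau> x * \<tau> y = T * (\<sigma> x * ((S * T) * \<sigma> y)) * S" unfolding \<tau>_def
      using ST(1,2) c by (simp add: assoc_mult_mat[of _ n n _ n _ n])
    also have "\<dots> = T * (\<sigma> x * \<sigma> y) * S" using ST c by simp
    also have "\<dots> = \<tau> (x \<otimes> y)" using rp(2)[OF xy] by (simp add: \<tau>_def)
    finally show ?thesis by simp
  qed
  have t1: "\<tau> \<one> = 1\<^sub>m n" using rp(3) ST by (simp add: \<tau>_def)
  \<comment> \<open>Column j < k of \<open>S\<close> lies in \<open>W\<close> and stays there under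
    the group, so its image has no coordinates from k on.\<close>
  have tz: "\<tau> g $$ (i,j) = 0" if g: "g \<in> carrier G" and ij: "k \<le> i" "i < n" "j < k" for g i j
  proof -
    have "\<sigma> g *\<^sub>v col S j \<in> W" using inv[OF g cols[OF ij(3)]] .
    then obtain v where v: "v \<in> carrier_vec n" "\<sigma> g *\<^sub>v col S j = S *\<^sub>v v" "\<forall>i. k \<le> i \<longrightarrow> i < n \<longrightarrow> v $ i = 0"
      using coord by metis
    have j: "j < n" using ij ST by auto
    have sg: "\<sigma> g \<in> carrier_mat n n" using rp g by auto
    have cj: "col S j \<in> carrier_vec n" using ST j by auto
    have "col (\<tau> g) j = (T * \<sigma> g) *\<^sub>v col S j"
      unfolding \<tau>_def by (rule col_mult2[of _ n n _ n]) (use ST sg j in auto)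
    also have "\<dots> = T *\<^sub>v (\<sigma> g *\<^sub>v col S j)" by (rule assoc_mult_mat_vec[OF ST(2) sg cj])
    also have "\<dots> = (T * S) *\<^sub>v v" unfolding v(2) by (rule assoc_mult_mat_vec[OF ST(2,1) v(1), symmetric])
    also have "\<dots> = v" using ST(4) v(1) by simp
    finally have "col (\<tau> g) j $ i = v $ i" by simp
    then show ?thesis using v(3) ij tc[OF g] j by auto
  qed
  define \<sigma>1 where "\<sigma>1 = (\<lambda>g. fst (split_block (\<tau> g) k k))"
  define \<sigma>2 where "\<sigma>2 = (\<lambda>g. snd (snd (snd (split_block (\<tau> g) k k))))"
  define B where "B = (\<lambda>g. fst (snd (split_block (\<tau> g) k k)))"
  have blk: "\<sigma>1 g \<in> carrier_mat k k" "B g \<in> carrier_mat k (n-k)" "\<sigma>2 g \<in> carrier_mat (n-k) (n-k)"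
    "\<tau> g = four_block_mat (\<sigma>1 g) (B g) (0\<^sub>m (n-k) k) (\<sigma>2 g)" if g: "g \<in> carrier G" for g
    using split_block_zero[OF tc[OF g] ST(5) tz[OF g], of "\<sigma>1 g" "B g" "fst (snd (snd (split_block (\<tau> g) k k)))" "\<sigma>2 g"]
    by (auto simp: \<sigma>1_def \<sigma>2_def B_def)
  \<comment> \<open>Equal block matrices have equal diagonal blocks; this reads multiplicativity of
    both diagonal parts off that of \<open>\<tau>\<close>.\<close>
  have inj: "A1 = A1' \<and> A4 = A4'" if "four_block_mat A1 A2 A3 A4 = four_block_mat A1' A2' A3' A4'"
     "A1 \<in> carrier_mat k k" "A4 \<in> carrier_mat (n-k) (n-k)" "A1' \<in> carrier_mat k k" "A4' \<in> carrier_mat (n-k) (n-k)"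
    for A1 A2 A3 A4 A1' A2' A3' A4' :: "complex mat"
  proof
    show "A1 = A1'"
    proof (rule eq_matI)
      fix i j assume "i < dim_row A1'" "j < dim_col A1'"
      then have ij: "i < k" "j < k" using that by auto
      have "four_block_mat A1 A2 A3 A4 $$ (i,j) = four_block_mat A1' A2' A3' A4' $$ (i,j)" using that(1) by simp
      then show "A1 $$ (i,j) = A1' $$ (i,j)" using that(2-) ij by auto
    qed (use that in auto)
    show "A4 = A4'"
    proof (rule eq_matI)
      fix i j assume "i < dim_row A4'" "j < dim_col A4'"
      then have ij: "i < n - k" "j < n - k" using that by auto
      have "four_block_mat A1 A2 A3 A4 $$ (k+i,k+j) = four_block_mat A1' A2' A3' A4' $$ (k+i,k+j)" using that(1) by simp
      then show "A4 $$ (i,j) = A4' $$ (i,j)" using that(2-) ij by auto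
    qed (use that in auto)
  qed
  have mult: "\<sigma>1 (x \<otimes> y) = \<sigma>1 x * \<sigma>1 y \<and> \<sigma>2 (x \<otimes> y) = \<sigma>2 x * \<sigma>2 y" if xy: "x \<in> carrier G" "y \<in> carrier G" for x y
  proof (rule inj)
    have "\<tau> x * \<tau> y = four_block_mat (\<sigma>1 x * \<sigma>1 y + B x * 0\<^sub>m (n-k) k) (\<sigma>1 x * B y + B x * \<sigma>2 y)
       (0\<^sub>m (n-k) k * \<sigma>1 y + \<sigma>2 x * 0\<^sub>m (n-k) k) (0\<^sub>m (n-k) k * B y + \<sigma>2 x * \<sigma>2 y)"
      unfolding blk(4)[OF xy(1)] blk(4)[OF xy(2)]
      by (rule mult_four_block_mat) (use blk[OF xy(1)] blk[OF xy(2)] in auto)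
    also have "\<sigma>1 x * \<sigma>1 y + B x * 0\<^sub>m (n-k) k = \<sigma>1 x * \<sigma>1 y"
      using blk(1-3)[OF xy(1)] blk(1-3)[OF xy(2)] by (simp add: right_mult_zero_mat[of _ k "n-k"] right_add_zero_mat[of _ k k])
    also have "0\<^sub>m (n-k) k * B y + \<sigma>2 x * \<sigma>2 y = \<sigma>2 x * \<sigma>2 y"
      using blk(1-3)[OF xy(1)] blk(1-3)[OF xy(2)] by (simp add: left_mult_zero_mat[of _ k "n-k"] left_add_zero_mat[of _ "n-k" "n-k"])
    finally show "four_block_mat (\<sigma>1 (x \<otimes> y)) (B (x \<otimes> y)) (0\<^sub>m (n-k) k) (\<sigma>2 (x \<otimes> y)) =
      four_block_mat (\<sigma>1 x * \<sigma>1 y) (\<sigma>1 x * B y + B x * \<sigma>2 y) (0\<^sub>m (n-k) k * \<sigma>1 y + \<sigma>2 x * 0\<^sub>m (n-k) k) (\<sigma>2 x * \<sigma>2 y)"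
      using tm[OF xy] blk(4)[of "x \<otimes> y"] xy by simp
  qed (use blk[OF xy(1)] blk[OF xy(2)] blk[of "x \<otimes> y"] xy in auto)
  have one: "\<sigma>1 \<one> = 1\<^sub>m k \<and> \<sigma>2 \<one> = 1\<^sub>m (n-k)"
  proof (rule inj)
    show "four_block_mat (\<sigma>1 \<one>) (B \<one>) (0\<^sub>m (n-k) k) (\<sigma>2 \<one>) = four_block_mat (1\<^sub>m k) (0\<^sub>m k (n-k)) (0\<^sub>m (n-k) k) (1\<^sub>m (n-k))"
      using blk(4)[of \<one>] t1 ST(5) by (simp add: four_block_one_mat)
  qed (use blk[of \<one>] in auto)
  show thesis
  proof (rule that[of k \<sigma>1 \<sigma>2])
    show "0 < k" "k < n" using k0 kn ST(5) by auto
    show "is_repr G k \<sigma>1" "is_repr G (n - k) \<sigma>2"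
      using blk mult one by (auto simp: is_repr_iff[OF G])
    fix g assume g: "g \<in> carrier G"
    have "mat_trace (\<sigma> g) = mat_trace (\<tau> g)" unfolding \<tau>_def
      by (rule mat_trace_conjugate[symmetric]) (use rp(1)[OF g] ST in auto)
    also have "\<dots> = mat_trace (\<sigma>1 g) + mat_trace (\<sigma>2 g)"
      using mat_trace_four_block[OF blk(1,3)[OF g]] blk(4)[OF g] by metis
    finally show "mat_trace (\<sigma> g) = mat_trace (\<sigma>1 g) + mat_trace (\<sigma>2 g)" .
  qed
qed

text \<open>The constituents form a list, so that multiplicities are kept. Degree 0, which
  \<open>is_repr\<close> allows but \<open>irr_repr\<close> does not, gives the empty list and
  starts the induction on the degree.\<close>

lemma repr_trace_sum_Irr:
  assumes G: "group G" and "is_repr G n \<sigma>"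
  shows "\<exists>ps. set ps \<subseteq> Irr G \<and> (\<forall>g\<in>carrier G. mat_trace (\<sigma> g) = (\<Sum>\<psi>\<leftarrow>ps. \<psi> g))"
  using assms(2)
proof (induct n arbitrary: \<sigma> rule: less_induct)
  case (less n)
  consider "n = 0" | "irr_repr G n \<sigma>" | "n > 0" "\<not> irr_repr G n \<sigma>" by blast
  then show ?case
  proof cases
    case 1
    then have "mat_trace (\<sigma> g) = 0" if "g \<in> carrier G" for g
      using less(2) that by (auto simp: is_repr_iff[OF G] mat_trace_def)
    then show ?thesis by (intro exI[of _ "[]"]) auto
  next
    case 2
    then show ?thesis by (intro exI[of _ "[character_of G \<sigma>]"]) (auto simp: Irr_def character_of_def)
  next
    case 3
    then obtain W where W: "VectorSpace.subspace class_ring W (module_vec TYPE(complex) n)"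
       "\<forall>g\<in>carrier G. \<forall>w\<in>W. \<sigma> g *\<^sub>v w \<in> W" "W \<noteq> {0\<^sub>v n}" "W \<noteq> carrier_vec n"
      using less(2) by (auto simp: irr_repr_def)
    obtain k \<sigma>1 \<sigma>2 where k: "0 < k" "k < n" "is_repr G k \<sigma>1" "is_repr G (n - k) \<sigma>2"
      "\<And>g. g \<in> carrier G \<Longrightarrow> mat_trace (\<sigma> g) = mat_trace (\<sigma>1 g) + mat_trace (\<sigma>2 g)"
      using invariant_subspace_split[OF G less(2) W(1) _ W(3,4)] W(2) by metis
    obtain ps qs where "set ps \<subseteq> Irr G" "\<forall>g\<in>carrier G. mat_trace (\<sigma>1 g) = (\<Sum>\<psi>\<leftarrow>ps. \<psi> g)"
       "set qs \<subseteq> Irr G" "\<forall>g\<in>carrier G. mat_trace (\<sigma>2 g) = (\<Sum>\<psi>\<leftarrow>qs. \<psi> g)"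
      using less(1)[OF k(2,3)] less(1)[OF _ k(4)] k by auto
    then show ?thesis using k(5) by (intro exI[of _ "ps @ qs"]) auto
  qed
qed

section \<open>Constituents of restricted and induced characters\<close>

lemma char_inner_sum_list:
  assumes "\<And>g. g \<in> carrier G \<Longrightarrow> \<chi> g = (\<Sum>\<psi>\<leftarrow>ps. \<psi> g)"
  shows "char_inner G \<phi> \<chi> = (\<Sum>\<psi>\<leftarrow>ps. char_inner G \<phi> \<psi>)"
proof -
  have "char_inner G \<phi> \<chi> = char_inner G \<phi> (\<lambda>g. \<Sum>\<psi>\<leftarrow>ps. \<psi> g)"
    using assms by (simp add: char_inner_def cong: sum.cong)
  also have "\<dots> = (\<Sum>\<psi>\<leftarrow>ps. char_inner G \<phi> \<psi>)"
    by (induct ps) (auto simp: char_inner_def ring_distribs sum.distrib add_divide_distrib)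
  finally show ?thesis .
qed

text \<open>One summand is the norm 1 of \<open>\<phi>\<close>, and the others are non-negative
  reals.\<close>

lemma char_inner_Irr_sum_nonzero:
  assumes G: "group G" "finite (carrier G)" and "\<phi> \<in> set ps" "set ps \<subseteq> Irr G"
  shows "(\<Sum>\<psi>\<leftarrow>ps. char_inner G \<phi> \<psi>) \<noteq> 0"
proof -
  have \<phi>: "\<phi> \<in> Irr G" using assms by auto
  have "\<forall>\<psi>\<in>Irr G. \<exists>r. r \<ge> (0::real) \<and> char_inner G \<phi> \<psi> = of_real r"
    using char_inner_Irr_nonneg[OF G \<phi>] by metis
  then obtain r where r: "\<And>\<psi>. \<psi> \<in> Irr G \<Longrightarrow> r \<psi> \<ge> (0::real)" "\<And>\<psi>. \<psi> \<in> Irr G \<Longrightarrow> char_inner G \<phi> \<psi> = of_real (r \<psi>)"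
    by metis
  have r1: "r \<phi> = 1" using r(2)[OF \<phi>] char_inner_Irr_self[OF G \<phi>] by simp
  have "(\<Sum>\<psi>\<leftarrow>qs. char_inner G \<phi> \<psi>) = of_real (\<Sum>\<psi>\<leftarrow>qs. r \<psi>)" if "set qs \<subseteq> Irr G" for qs
    using that by (induct qs) (auto simp: r(2))
  moreover have nn: "(\<Sum>\<psi>\<leftarrow>qs. r \<psi>) \<ge> 0" if "set qs \<subseteq> Irr G" for qs
    using that by (intro sum_list_nonneg) (auto simp: r(1))
  moreover have "(\<Sum>\<psi>\<leftarrow>ps. r \<psi>) > 0"
  proof -
    obtain xs ys where ps: "ps = xs @ \<phi> # ys" using split_list[OF assms(3)] by auto
    show ?thesis using nn[of xs] nn[of ys] assms(4) r1 unfolding ps by auto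
  qed
  ultimately show ?thesis using assms(4) by simp
qed

lemma Irr_one_nonzero:
  assumes "group G" "\<phi> \<in> Irr G"
  shows "\<phi> \<one>\<^bsub>G\<^esub> \<noteq> 0"
proof -
  interpret group G by fact
  show ?thesis using assms by (auto simp: Irr_def irr_repr_def character_of_def is_repr_iff mat_trace_def)
qed

lemma is_repr_subgroup:
  assumes "group K" "subgroup H K" "is_repr K n \<rho>"
  shows "is_repr (K\<lparr>carrier := H\<rparr>) n \<rho>"
  using assms subgroup.subgroup_is_group[OF assms(2,1)]
  by (auto simp: is_repr_iff subgroup.mem_carrier)

text \<open>Decompose the restricted representation into irreducible characters of \<open>H\<close>;
  any entry of that list serves, here the first one.\<close>

lemma Irr_restrict_constituent:
  assumes K: "group K" "finite (carrier K)" and H: "subgroup H K" and \<psi>: "\<psi> \<in> Irr K"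
  shows "\<exists>\<phi>\<in>Irr (K\<lparr>carrier := H\<rparr>). char_inner (K\<lparr>carrier := H\<rparr>) \<phi> (restrict \<psi> H) \<noteq> 0"
proof -
  let ?H = "K\<lparr>carrier := H\<rparr>"
  have gH: "group ?H" using subgroup.subgroup_is_group[OF H K(1)] .
  have fH: "finite (carrier ?H)" using finite_subset[OF subgroup.subset[OF H] K(2)] by simp
  obtain n \<rho> where \<rho>: "irr_repr K n \<rho>" "\<psi> = character_of K \<rho>" using \<psi> by (auto simp: Irr_def)
  obtain ps where ps: "set ps \<subseteq> Irr ?H" "\<forall>g\<in>H. mat_trace (\<rho> g) = (\<Sum>\<psi>\<leftarrow>ps. \<psi> g)"
    using repr_trace_sum_Irr[OF gH is_repr_subgroup[OF K(1) H irr_repr_is_repr[OF \<rho>(1)]]] by auto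
  have e: "restrict \<psi> H g = (\<Sum>\<psi>\<leftarrow>ps. \<psi> g)" if "g \<in> H" for g
    using ps that subgroup.mem_carrier[OF H that] by (simp add: \<rho>(2) character_of_def)
  have "\<one>\<^bsub>K\<^esub> \<in> H" using H by (simp add: subgroup.one_closed)
  then have "(\<Sum>\<psi>\<leftarrow>ps. \<psi> \<one>\<^bsub>K\<^esub>) \<noteq> 0" using e[of "\<one>\<^bsub>K\<^esub>"] Irr_one_nonzero[OF K(1) \<psi>] by simp
  \<comment> \<open>The empty list would give the value 0 at the identity, where
    \<open>\<psi>\<close> takes its degree.\<close>
  then have "ps \<noteq> []" by auto
  then have hd: "hd ps \<in> set ps" by simp
  have "char_inner ?H (hd ps) (restrict \<psi> H) = (\<Sum>\<psi>\<leftarrow>ps. char_inner ?H (hd ps) \<psi>)"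
    by (rule char_inner_sum_list) (use e in auto)
  also have "\<dots> \<noteq> 0" by (rule char_inner_Irr_sum_nonzero[OF gH fH hd ps(1)])
  finally show ?thesis using hd ps by auto
qed

lemma regular_character_sum_Irr:
  fixes G (structure)
  assumes G: "group G" "finite (carrier G)"
  obtains ps where "set ps \<subseteq> Irr G"
    "\<And>g. g \<in> carrier G \<Longrightarrow> (\<Sum>\<psi>\<leftarrow>ps. \<psi> g) = (if g = \<one> then of_nat (card (carrier G)) else 0)"
proof -
  interpret group G by fact
  let ?N = "card (carrier G)"
  obtain f where f: "bij_betw f {0..<?N} (carrier G)" using ex_bij_betw_nat_finite[OF G(2)] by auto
  then have fc: "f i \<in> carrier G" if "i < ?N" for i using that by (auto simp: bij_betw_def)
  \<comment> \<open>Left multiplication as permutation matrices, with the group elements numbered by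
    \<open>f\<close>.\<close>
  define reg where "reg = (\<lambda>g. mat ?N ?N (\<lambda>(i,j). if f i = g \<otimes> f j then 1 else 0 :: complex))"
  have "reg (x \<otimes> y) = reg x * reg y" if xy: "x \<in> carrier G" "y \<in> carrier G" for x y
  proof (rule eq_matI)
    fix i j assume "i < dim_row (reg x * reg y)" "j < dim_col (reg x * reg y)"
    then have ij: "i < ?N" "j < ?N" by (auto simp: reg_def)
    have "y \<otimes> f j \<in> f ` {0..<?N}" using f xy fc ij by (auto simp: bij_betw_def)
    then obtain k where k: "k < ?N" "f k = y \<otimes> f j" by auto
    have "(reg x * reg y) $$ (i,j) = (\<Sum>l\<in>{0..<?N}. (if f i = x \<otimes> f l then 1 else 0) * (if f l = y \<otimes> f j then 1 else 0))"
      using ij by (simp add: reg_def scalar_prod_def)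
    also have "\<dots> = (\<Sum>l\<in>{0..<?N}. if l = k then (if f i = x \<otimes> f k then 1 else 0) else 0)"
    proof (rule sum.cong[OF refl])
      fix l assume l: "l \<in> {0..<?N}"
      have "f l = y \<otimes> f j \<longleftrightarrow> l = k" using f k l by (auto simp: bij_betw_def inj_on_def)
      then show "(if f i = x \<otimes> f l then 1 else 0) * (if f l = y \<otimes> f j then 1 else 0)
          = (if l = k then (if f i = x \<otimes> f k then 1 else 0) else (0::complex))" by simp
    qed
    also have "\<dots> = reg (x \<otimes> y) $$ (i,j)" using k ij xy fc by (simp add: reg_def m_assoc)
    finally show "reg (x \<otimes> y) $$ (i,j) = (reg x * reg y) $$ (i,j)" by simp
  qed (auto simp: reg_def)
  moreover have "reg \<one> = 1\<^sub>m ?N"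
    using f by (intro eq_matI) (auto simp: reg_def fc bij_betw_def inj_on_def)
  ultimately have rep: "is_repr G ?N reg" by (auto simp: is_repr_iff[OF G(1)] reg_def)
  obtain ps where ps: "set ps \<subseteq> Irr G" "\<forall>g\<in>carrier G. mat_trace (reg g) = (\<Sum>\<psi>\<leftarrow>ps. \<psi> g)"
    using repr_trace_sum_Irr[OF G(1) rep] by auto
  have tr: "mat_trace (reg g) = (if g = \<one> then of_nat ?N else 0)" if g: "g \<in> carrier G" for g
  proof -
    have "mat_trace (reg g) = (\<Sum>i<?N. if g = \<one> then 1 else 0)"
      unfolding mat_trace_def
    proof (rule sum.cong)
      fix i assume "i \<in> {..<?N}"
      then have i: "i < ?N" by simp
      \<comment> \<open>Left multiplication by \<open>g\<close> fixes an element only if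
        \<open>g\<close> is the identity, so off the identity the diagonal is zero.\<close>
      have "f i = g \<otimes> f i \<longleftrightarrow> g = \<one>" using fc[OF i] g by (metis l_one one_closed right_cancel)
      then show "reg g $$ (i,i) = (if g = \<one> then 1 else 0)" using i by (simp add: reg_def)
    qed (simp add: reg_def)
    then show ?thesis by simp
  qed
  show thesis by (rule that[OF ps(1)]) (use ps(2) tr in auto)
qed

text \<open>On any subgroup the regular character of \<open>K\<close> is supported at the identity,
  so its inner product with \<open>\<phi>\<close> is phi(1) |K| / |H|, which is non-zero; hence some
  constituent contributes. This stands in for inducing \<open>\<phi>\<close>. The set
  \<open>X\<close> is chosen before \<open>H\<close> and \<open>\<phi>\<close>, which is what later
  bounds the number of components.\<close>

lemma Irr_extension_constituent:
  assumes K: "group K" "finite (carrier K)"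
  obtains X where "finite X" "X \<subseteq> Irr K"
    "\<And>H \<phi>. subgroup H K \<Longrightarrow> \<phi> \<in> Irr (K\<lparr>carrier := H\<rparr>) \<Longrightarrow>
       \<exists>\<psi>\<in>X. char_inner (K\<lparr>carrier := H\<rparr>) \<phi> (restrict \<psi> H) \<noteq> 0"
proof -
  obtain ps where ps: "set ps \<subseteq> Irr K"
    "\<And>g. g \<in> carrier K \<Longrightarrow> (\<Sum>\<psi>\<leftarrow>ps. \<psi> g) = (if g = \<one>\<^bsub>K\<^esub> then of_nat (card (carrier K)) else 0)"
    using regular_character_sum_Irr[OF K] by metis
  show thesis
  proof (rule that[of "set ps"])
    fix H \<phi> assume H: "subgroup H K" and \<phi>: "\<phi> \<in> Irr (K\<lparr>carrier := H\<rparr>)"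
    let ?H = "K\<lparr>carrier := H\<rparr>"
    have gH: "group ?H" using subgroup.subgroup_is_group[OF H K(1)] .
    have fH: "finite H" using finite_subset[OF subgroup.subset[OF H] K(2)] .
    have oH: "\<one>\<^bsub>K\<^esub> \<in> H" using H by (simp add: subgroup.one_closed)
    let ?\<chi> = "\<lambda>g. if g = \<one>\<^bsub>K\<^esub> then of_nat (card (carrier K)) else 0 :: complex"
    have "char_inner ?H \<phi> ?\<chi> = (\<Sum>\<psi>\<leftarrow>map (\<lambda>\<psi>. restrict \<psi> H) ps. char_inner ?H \<phi> \<psi>)"
      by (rule char_inner_sum_list) (use ps(2) subgroup.mem_carrier[OF H] in \<open>auto simp: o_def\<close>)
    moreover have "char_inner ?H \<phi> ?\<chi> \<noteq> 0"
    proof -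
      have "(\<Sum>g\<in>H. \<phi> g * cnj (?\<chi> g)) = (\<Sum>g\<in>H. if g = \<one>\<^bsub>K\<^esub> then \<phi> \<one>\<^bsub>K\<^esub> * of_nat (card (carrier K)) else 0)"
        by (rule sum.cong) auto
      then show ?thesis using fH oH K Irr_one_nonzero[OF gH \<phi>] group.is_monoid[OF K(1)] monoid.one_closed
        by (fastforce simp: char_inner_def)
    qed
    moreover have "(\<Sum>\<psi>\<leftarrow>qs. h \<psi>) = 0" if "\<forall>\<psi>\<in>set qs. h \<psi> = 0"
      for qs and h :: "('a \<Rightarrow> complex) \<Rightarrow> complex"
      using that by (induct qs) auto
    ultimately show "\<exists>\<psi>\<in>set ps. char_inner ?H \<phi> (restrict \<psi> H) \<noteq> 0"
      by (metis (no_types, lifting) image_iff list.set_map)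
  qed (use ps in auto)
qed

section \<open>Isomorphisms and characters of degree one\<close>

lemma Irr_iso:
  assumes G: "group G" and K: "group K" and f: "f \<in> iso G K" and \<phi>: "\<phi> \<in> Irr K"
  shows "restrict (\<phi> \<circ> f) (carrier G) \<in> Irr G"
proof -
  obtain n \<rho> where \<rho>: "irr_repr K n \<rho>" "\<phi> = character_of K \<rho>" using \<phi> by (auto simp: Irr_def)
  have fc: "f ` carrier G = carrier K" and h: "f \<in> hom G K" using f by (auto simp: iso_def bij_betw_def)
  have fcl: "\<And>x. x \<in> carrier G \<Longrightarrow> f x \<in> carrier K" using fc by auto
  have f1: "f \<one>\<^bsub>G\<^esub> = \<one>\<^bsub>K\<^esub>" using hom_one[OF h G K] .
  have "is_repr G n (\<rho> \<circ> f)"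
    using irr_repr_is_repr[OF \<rho>(1)] fcl f1 h by (auto simp: is_repr_iff[OF G] is_repr_iff[OF K] hom_mult)
  then have "irr_repr G n (\<rho> \<circ> f)"
    using \<rho>(1) unfolding irr_repr_def fc[symmetric] by simp
  moreover have "restrict (\<phi> \<circ> f) (carrier G) = character_of G (\<rho> \<circ> f)"
    by (rule ext) (auto simp: \<rho>(2) character_of_def fcl)
  ultimately show ?thesis by (auto simp: Irr_def)
qed

lemma linear_character_Irr:
  fixes G (structure)
  assumes G: "group G" and m: "\<And>x y. x \<in> carrier G \<Longrightarrow> y \<in> carrier G \<Longrightarrow> \<mu> (x \<otimes> y) = \<mu> x * \<mu> y"
    and o: "\<mu> \<one> = 1"
  shows "restrict \<mu> (carrier G) \<in> Irr G"
proof -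
  define \<rho> where "\<rho> = (\<lambda>g. mat 1 1 (\<lambda>_. \<mu> g))"
  have rep: "is_repr G 1 \<rho>"
    unfolding is_repr_iff[OF G] \<rho>_def using m o by (auto intro!: eq_matI simp: scalar_prod_def)
  have "W = {0\<^sub>v 1} \<or> W = carrier_vec 1" if W: "VectorSpace.subspace class_ring W (module_vec TYPE(complex) 1)" for W
  proof (rule disjCI)
    assume "W \<noteq> carrier_vec 1"
    have Ws: "W \<subseteq> carrier_vec 1" "0\<^sub>v 1 \<in> W" "\<And>c v. v \<in> W \<Longrightarrow> c \<cdot>\<^sub>v v \<in> W" using W by (auto simp: subspace_vec_iff)
    have "w = 0\<^sub>v 1" if w: "w \<in> W" for w
    proof (rule ccontr)
      assume "w \<noteq> 0\<^sub>v 1"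
      then have w0: "w $ 0 \<noteq> 0" "dim_vec w = 1" using w Ws by (auto simp: vec_eq_iff)
      have "v \<in> W" if "v \<in> carrier_vec 1" for v
      proof -
        have "v = (v $ 0 / w $ 0) \<cdot>\<^sub>v w" using w0 that by (auto simp: vec_eq_iff)
        then show ?thesis using Ws(3)[OF w] by metis
      qed
      then show False using \<open>W \<noteq> carrier_vec 1\<close> Ws(1) by blast
    qed
    then show "W = {0\<^sub>v 1}" using Ws(2) by blast
  qed
  then have "irr_repr G 1 \<rho>" using rep by (auto simp: irr_repr_def)
  moreover have "restrict \<mu> (carrier G) = character_of G \<rho>"
    by (rule ext) (auto simp: character_of_def \<rho>_def mat_trace_def)
  ultimately show ?thesis by (auto simp: Irr_def)
qed

text \<open>Each matrix commutes with all the others, so it is scalar by Schur's lemma. Then every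
  line is invariant, and irreducibility forces degree 1.\<close>

lemma comm_group_Irr_linear:
  fixes G (structure)
  assumes G: "comm_group G" and \<phi>: "\<phi> \<in> Irr G"
  shows "\<phi> \<one> = 1" "x \<in> carrier G \<Longrightarrow> y \<in> carrier G \<Longrightarrow> \<phi> (x \<otimes> y) = \<phi> x * \<phi> y"
proof -
  interpret comm_group G by fact
  have G': "group G" by (rule is_group)
  obtain n \<rho> where irr: "irr_repr G n \<rho>" and \<phi>': "\<phi> = character_of G \<rho>" using \<phi> by (auto simp: Irr_def)
  have rp: "\<And>g. g \<in> carrier G \<Longrightarrow> \<rho> g \<in> carrier_mat n n"
     "\<And>x y. x \<in> carrier G \<Longrightarrow> y \<in> carrier G \<Longrightarrow> \<rho> (x \<otimes> y) = \<rho> x * \<rho> y" "\<rho> \<one> = 1\<^sub>m n" and n: "n > 0"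
    using irr by (auto simp: irr_repr_def is_repr_iff[OF G'])
  have sc: "\<exists>c. \<rho> g = c \<cdot>\<^sub>m 1\<^sub>m n" if g: "g \<in> carrier G" for g
    using schur_lemma[OF G' irr rp(1)[OF g]] rp(2) g m_comm by metis
  \<comment> \<open>The line spanned by the first unit vector.\<close>
  define W where "W = {v \<in> carrier_vec n. \<forall>i<n. i > 0 \<longrightarrow> v $ i = (0::complex)}"
  have "VectorSpace.subspace class_ring W (module_vec TYPE(complex) n)"
    by (auto simp: subspace_vec_iff W_def)
  moreover have "\<rho> g *\<^sub>v w \<in> W" if g: "g \<in> carrier G" and w: "w \<in> W" for g w
  proof -
    obtain c where "\<rho> g = c \<cdot>\<^sub>m 1\<^sub>m n" using sc[OF g] by auto
    moreover have "(c \<cdot>\<^sub>m 1\<^sub>m n) *\<^sub>v w = c \<cdot>\<^sub>v w"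
      using w by (intro eq_vecI) (auto simp: W_def)
    ultimately show ?thesis using w by (auto simp: W_def)
  qed
  ultimately have "W = {0\<^sub>v n} \<or> W = carrier_vec n" using irr by (auto simp: irr_repr_def)
  moreover have "unit_vec n 0 \<in> W" "unit_vec n 0 \<noteq> 0\<^sub>v n" using n by (auto simp: W_def)
  ultimately have W: "W = carrier_vec n" by auto
  have n1: "n = 1"
  proof (rule ccontr)
    assume "n \<noteq> 1"
    then have "1 < n" using n by simp
    moreover have "unit_vec n 1 \<in> W" using W by simp
    ultimately show False by (auto simp: W_def)
  qed
  have \<phi>g: "\<phi> g = \<rho> g $$ (0,0)" if "g \<in> carrier G" for g
    using rp(1)[OF that] that by (auto simp: \<phi>' character_of_def mat_trace_def n1)
  show "\<phi> \<one> = 1" using \<phi>g[of \<one>] rp(3) n1 by simp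
  show "\<phi> (x \<otimes> y) = \<phi> x * \<phi> y" if "x \<in> carrier G" "y \<in> carrier G"
    using \<phi>g that rp(1)[of x] rp(1)[of y] rp(2)[of x y] n1 by (simp add: scalar_prod_def)
qed

section \<open>Components of posets\<close>

lemma poset_conn_refl: "x \<in> A \<Longrightarrow> poset_conn A R x x"
  by (simp add: poset_conn_def)

lemma poset_conn_step: "x \<in> A \<Longrightarrow> y \<in> A \<Longrightarrow> R x y \<or> R y x \<Longrightarrow> poset_conn A R x y"
  unfolding poset_conn_def by (intro conjI r_into_rtranclp) auto

lemma poset_conn_trans: "poset_conn A R x y \<Longrightarrow> poset_conn A R y z \<Longrightarrow> poset_conn A R x z"
  unfolding poset_conn_def by (meson rtranclp_trans)

lemma poset_conn_sym: "poset_conn A R x y \<Longrightarrow> poset_conn A R y x"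
proof -
  assume a: "poset_conn A R x y"
  let ?S = "\<lambda>a b. a \<in> A \<and> b \<in> A \<and> (R a b \<or> R b a)"
  have "symp ?S" by (auto intro: sympI)
  then have "?S\<^sup>*\<^sup>* y x" using a unfolding poset_conn_def by (meson symp_rtranclp sympD)
  moreover have "y \<in> A"
    using a unfolding poset_conn_def by (metis (no_types, lifting) rtranclp.cases)
  ultimately show ?thesis by (simp add: poset_conn_def)
qed

lemma poset_conn_in: "poset_conn A R x y \<Longrightarrow> x \<in> A \<and> y \<in> A"
  using poset_conn_sym[of A R x y] by (simp add: poset_conn_def)

lemma poset_conn_image:
  assumes "poset_conn A R x y" and "\<And>a. a \<in> A \<Longrightarrow> f a \<in> B"
    and "\<And>a b. a \<in> A \<Longrightarrow> b \<in> A \<Longrightarrow> R a b \<Longrightarrow> S (f a) (f b)"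
  shows "poset_conn B S (f x) (f y)"
proof -
  have x: "x \<in> A" and "(\<lambda>a b. a \<in> A \<and> b \<in> A \<and> (R a b \<or> R b a))\<^sup>*\<^sup>* x y"
    using assms(1) by (auto simp: poset_conn_def)
  from this(2) show ?thesis
  proof (induct rule: rtranclp_induct)
    case base
    then show ?case by (rule poset_conn_refl) (use x assms(2) in auto)
  next
    case (step y z)
    have "poset_conn B S (f y) (f z)"
      by (rule poset_conn_step) (use step(2) assms(2,3) in auto)
    then show ?case by (rule poset_conn_trans[OF step(3)])
  qed
qed

lemma poset_component_eq_iff:
  assumes "x \<in> A" "y \<in> A"
  shows "poset_component A R x = poset_component A R y \<longleftrightarrow> poset_conn A R x y"
  unfolding poset_component_def
  using assms poset_conn_refl[of _ A R] poset_conn_sym[of A R] poset_conn_trans[of A R] by blast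

text \<open>On \<open>X\<close> the map \<open>g\<close> factors through \<open>f\<close>, by
  choosing a preimage for every value of \<open>f\<close>. This compares two quotients of one set
  without naming a map between them.\<close>

lemma card_image_coarser:
  assumes "finite (f ` X)" "\<And>x y. x \<in> X \<Longrightarrow> y \<in> X \<Longrightarrow> f x = f y \<Longrightarrow> g x = g y"
  shows "finite (g ` X) \<and> card (g ` X) \<le> card (f ` X)"
proof -
  have e: "g ` X = (\<lambda>c. g (SOME x. x \<in> X \<and> f x = c)) ` (f ` X)"
    unfolding image_image
  proof (rule image_cong[OF refl])
    fix x assume x: "x \<in> X"
    have "(SOME y. y \<in> X \<and> f y = f x) \<in> X \<and> f (SOME y. y \<in> X \<and> f y = f x) = f x"
      by (rule someI[of _ x]) (use x in auto)
    then show "g x = g (SOME y. y \<in> X \<and> f y = f x)" by (intro assms(2)[OF x]) auto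
  qed
  show ?thesis unfolding e by (intro conjI finite_imageI card_image_le assms(1))
qed

lemma pi0_image_of_surj:
  assumes "\<And>a. a \<in> A \<Longrightarrow> f a \<in> B" "\<And>b. b \<in> B \<Longrightarrow> \<exists>a\<in>A. poset_conn B S (f a) b"
  shows "pi0 B S = (\<lambda>a. poset_component B S (f a)) ` A"
proof
  show "pi0 B S \<subseteq> (\<lambda>a. poset_component B S (f a)) ` A"
  proof
    fix C assume "C \<in> pi0 B S"
    then obtain b where b: "b \<in> B" "C = poset_component B S b" by (auto simp: pi0_def)
    obtain a where a: "a \<in> A" "poset_conn B S (f a) b" using assms(2)[OF b(1)] by blast
    then have "C = poset_component B S (f a)"
      using poset_component_eq_iff[OF assms(1)[OF a(1)] b(1), of S] b(2) by simp
    then show "C \<in> (\<lambda>a. poset_component B S (f a)) ` A" using a(1) by simp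
  qed
  show "(\<lambda>a. poset_component B S (f a)) ` A \<subseteq> pi0 B S"
    using assms(1) by (auto simp: pi0_def)
qed

text \<open>Surjectivity is asked only up to connectedness: in the application an element of X(P)
  need not lie in the image, it is merely joined to it.\<close>

lemma pi0_card_surj:
  assumes "finite (pi0 A R)" and f: "\<And>a. a \<in> A \<Longrightarrow> f a \<in> B"
    and mono: "\<And>a b. a \<in> A \<Longrightarrow> b \<in> A \<Longrightarrow> R a b \<Longrightarrow> S (f a) (f b)"
    and surj: "\<And>b. b \<in> B \<Longrightarrow> \<exists>a\<in>A. poset_conn B S (f a) b"
  shows "finite (pi0 B S) \<and> card (pi0 B S) \<le> card (pi0 A R)"
proof -
  have eq: "pi0 B S = (\<lambda>a. poset_component B S (f a)) ` A"
    by (rule pi0_image_of_surj) (use f surj in auto)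
  show ?thesis unfolding eq unfolding pi0_def[of A R]
  proof (rule card_image_coarser)
  show "finite (poset_component A R ` A)" using assms(1) by (simp add: pi0_def)
  show "poset_component B S (f a) = poset_component B S (f b)"
    if "a \<in> A" "b \<in> A" "poset_component A R a = poset_component A R b" for a b
    using that f poset_conn_image[of A R a b f B S] mono by (simp add: poset_component_eq_iff)
  qed
qed

lemma pi0_card_iso:
  assumes "finite (pi0 A R)" and f: "\<And>a. a \<in> A \<Longrightarrow> f a \<in> B" and h: "\<And>b. b \<in> B \<Longrightarrow> h b \<in> A"
    and fm: "\<And>a b. a \<in> A \<Longrightarrow> b \<in> A \<Longrightarrow> R a b \<Longrightarrow> S (f a) (f b)"
    and hm: "\<And>a b. a \<in> B \<Longrightarrow> b \<in> B \<Longrightarrow> S a b \<Longrightarrow> R (h a) (h b)"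
    and fh: "\<And>b. b \<in> B \<Longrightarrow> f (h b) = b" and hf: "\<And>a. a \<in> A \<Longrightarrow> h (f a) = a"
  shows "finite (pi0 B S) \<and> card (pi0 B S) = card (pi0 A R)"
proof -
  have 1: "finite (pi0 B S) \<and> card (pi0 B S) \<le> card (pi0 A R)"
    by (rule pi0_card_surj[where f = f]) (use assms poset_conn_refl in metis)+
  have "finite (pi0 A R) \<and> card (pi0 A R) \<le> card (pi0 B S)"
    by (rule pi0_card_surj[where f = h]) (use 1 assms poset_conn_refl in metis)+
  then show ?thesis using 1 by simp
qed

text \<open>A path upstairs projects to a path downstairs, so it never leaves the preimage of a
  single component. The components of \<open>A\<close> are therefore the disjoint union of the
  components of these preimages.\<close>

lemma pi0_card_fibres:
  assumes "finite (pi0 B S)" and f: "\<And>a. a \<in> A \<Longrightarrow> f a \<in> B"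
    and mono: "\<And>a b. a \<in> A \<Longrightarrow> b \<in> A \<Longrightarrow> R a b \<Longrightarrow> S (f a) (f b)"
    and fib: "\<And>C. C \<in> pi0 B S \<Longrightarrow> finite (pi0 {a\<in>A. f a \<in> C} R) \<and> card (pi0 {a\<in>A. f a \<in> C} R) = m"
  shows "card (pi0 A R) = m * card (pi0 B S)"
proof -
  let ?F = "\<lambda>C. {a\<in>A. f a \<in> C}"
  \<comment> \<open>The induction along the path shows that each new point still projects into the
    component of \<open>f a\<close>.\<close>
  have conn: "poset_conn A R a b \<longleftrightarrow> poset_conn (?F (poset_component B S (f a))) R a b" if a: "a \<in> A" for a b
  proof
    assume "poset_conn A R a b"
    then have "(\<lambda>a b. a \<in> A \<and> b \<in> A \<and> (R a b \<or> R b a))\<^sup>*\<^sup>* a b" by (simp add: poset_conn_def)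
    then show "poset_conn (?F (poset_component B S (f a))) R a b"
    proof (induct rule: rtranclp_induct)
      case base
      show ?case by (rule poset_conn_refl) (use a f in \<open>simp add: poset_component_def poset_conn_refl\<close>)
    next
      case (step b c)
      have fb: "poset_conn B S (f a) (f b)" using poset_conn_in[OF step(3)] by (simp add: poset_component_def)
      moreover have "poset_conn B S (f b) (f c)"
        by (rule poset_conn_step) (use step(2) f mono in auto)
      ultimately have "poset_conn B S (f a) (f c)" by (rule poset_conn_trans)
      then have "poset_conn (?F (poset_component B S (f a))) R b c"
        by (intro poset_conn_step) (use step(2) fb in \<open>auto simp: poset_component_def\<close>)
      then show ?case by (rule poset_conn_trans[OF step(3)])
    qed
  next
    assume "poset_conn (?F (poset_component B S (f a))) R a b"
    then show "poset_conn A R a b" by (rule poset_conn_image[where f = "\<lambda>x. x"]) auto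
  qed
  have comp: "poset_component A R a = poset_component (?F C) R a" if C: "C \<in> pi0 B S" and a: "a \<in> ?F C" for C a
  proof -
    obtain b where b: "b \<in> B" "C = poset_component B S b" using C by (auto simp: pi0_def)
    have "poset_conn B S b (f a)" using a b by (simp add: poset_component_def)
    then have "C = poset_component B S (f a)"
      using b a f poset_component_eq_iff[of b B "f a" S] by simp
    then show ?thesis using conn[of a] a by (simp add: poset_component_def)
  qed
  have un: "pi0 A R = (\<Union>C\<in>pi0 B S. pi0 (?F C) R)"
  proof
    show "pi0 A R \<subseteq> (\<Union>C\<in>pi0 B S. pi0 (?F C) R)"
    proof
      fix D assume "D \<in> pi0 A R"
      then obtain a where a: "a \<in> A" "D = poset_component A R a" by (auto simp: pi0_def)
      let ?C = "poset_component B S (f a)"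
      have "?C \<in> pi0 B S" "a \<in> ?F ?C" using a f by (auto simp: pi0_def poset_component_def poset_conn_refl)
      then show "D \<in> (\<Union>C\<in>pi0 B S. pi0 (?F C) R)" using comp[of ?C a] a(2)
        by (intro UN_I[of ?C]) (auto simp: pi0_def)
    qed
    show "(\<Union>C\<in>pi0 B S. pi0 (?F C) R) \<subseteq> pi0 A R"
      using comp by (auto simp: pi0_def)
  qed
  have "card (\<Union>C\<in>pi0 B S. pi0 (?F C) R) = (\<Sum>C\<in>pi0 B S. card (pi0 (?F C) R))"
  proof (rule card_UN_disjoint)
    show "\<forall>C\<in>pi0 B S. \<forall>C'\<in>pi0 B S. C \<noteq> C' \<longrightarrow> pi0 (?F C) R \<inter> pi0 (?F C') R = {}"
    proof (intro ballI impI, rule ccontr)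
      fix C C' assume C: "C \<in> pi0 B S" "C' \<in> pi0 B S" "C \<noteq> C'" and ne: "pi0 (?F C) R \<inter> pi0 (?F C') R \<noteq> {}"
      then obtain a a' where aa: "a \<in> ?F C" "a' \<in> ?F C'" "poset_component (?F C) R a = poset_component (?F C') R a'"
        by (auto simp: pi0_def)
      have "a \<in> poset_component (?F C) R a" using poset_conn_refl[OF aa(1)] by (simp add: poset_component_def)
      then have "a \<in> poset_component (?F C') R a'" using aa(3) by simp
      then have "a \<in> ?F C'" using poset_conn_in unfolding poset_component_def by fastforce
      then have fa: "f a \<in> C" "f a \<in> C'" using aa(1) by auto
      obtain b b' where b: "b \<in> B" "C = poset_component B S b" "b' \<in> B" "C' = poset_component B S b'"
        using C by (auto simp: pi0_def)
      then have "poset_conn B S b b'"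
        using fa poset_conn_trans[OF _ poset_conn_sym] by (auto simp: poset_component_def)
      then show False using C b poset_component_eq_iff[of b B b' S] by simp
    qed
  qed (use assms fib in auto)
  then show ?thesis using fib un by (simp add: mult.commute)
qed

section \<open>Conjugation and Sylow subgroups\<close>

context group
begin

definition conj_by :: "'a \<Rightarrow> 'a \<Rightarrow> 'a" where "conj_by g x = inv g \<otimes> x \<otimes> g"

lemma conj_by_closed [simp]: "g \<in> carrier G \<Longrightarrow> x \<in> carrier G \<Longrightarrow> conj_by g x \<in> carrier G"
  by (simp add: conj_by_def)

lemma conj_by_mult:
  assumes "g \<in> carrier G" "x \<in> carrier G" "y \<in> carrier G"
  shows "conj_by g (x \<otimes> y) = conj_by g x \<otimes> conj_by g y"
proof -
  have "g \<otimes> (inv g \<otimes> (y \<otimes> g)) = y \<otimes> g" using assms by (simp add: m_assoc[symmetric])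
  then show ?thesis using assms by (simp add: conj_by_def m_assoc)
qed

lemma conj_by_conj_by:
  "g \<in> carrier G \<Longrightarrow> h \<in> carrier G \<Longrightarrow> x \<in> carrier G \<Longrightarrow> conj_by h (conj_by g x) = conj_by (g \<otimes> h) x"
  by (simp add: conj_by_def inv_mult_group m_assoc)

lemma conj_by_inv [simp]:
  "g \<in> carrier G \<Longrightarrow> x \<in> carrier G \<Longrightarrow> conj_by (inv g) (conj_by g x) = x"
  "g \<in> carrier G \<Longrightarrow> x \<in> carrier G \<Longrightarrow> conj_by g (conj_by (inv g) x) = x"
  by (simp_all add: conj_by_conj_by) (simp_all add: conj_by_def)

lemma conj_by_inj: "g \<in> carrier G \<Longrightarrow> inj_on (conj_by g) (carrier G)"
  by (metis conj_by_inv(1) inj_onI)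

lemma conj_subgroup_image: "conj_subgroup G H g = conj_by g ` H"
  by (auto simp: conj_subgroup_def conj_by_def l_coset_def r_coset_def)

lemma conj_subgroup_subgroup:
  assumes H: "subgroup H G" and g: "g \<in> carrier G"
  shows "subgroup (conj_subgroup G H g) G"
proof -
  have Hc: "H \<subseteq> carrier G" using H by (rule subgroup.subset)
  have h: "conj_by g \<in> hom G G" using g by (auto simp: hom_def conj_by_mult)
  interpret group_hom G G "conj_by g" using h by unfold_locales
  show ?thesis unfolding conj_subgroup_image by (rule subgroup_img_is_subgroup[OF H])
qed

lemma conj_subgroup_card:
  assumes "H \<subseteq> carrier G" "g \<in> carrier G"
  shows "card (conj_subgroup G H g) = card H"
  unfolding conj_subgroup_image using conj_by_inj[OF assms(2)] assms(1)
  by (meson card_image inj_on_subset)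

lemma conj_subgroup_conj_subgroup:
  assumes "H \<subseteq> carrier G" "g \<in> carrier G" "h \<in> carrier G"
  shows "conj_subgroup G (conj_subgroup G H g) h = conj_subgroup G H (g \<otimes> h)"
  unfolding conj_subgroup_image image_image using assms by (intro image_cong) (auto simp: conj_by_conj_by)

lemma conj_subgroup_one: "H \<subseteq> carrier G \<Longrightarrow> conj_subgroup G H \<one> = H"
  unfolding conj_subgroup_image by (force simp: conj_by_def)

text \<open>The \<open>p\<close>-group \<open>H\<close> acts on the cosets of \<open>P\<close>, whose number is prime to \<open>p\<close>, so it fixes one.\<close>

lemma sylow_conj_contains:
  assumes fin: "finite (carrier G)" and p: "prime p" and P: "sylow_subgroup p G P"
    and H: "subgroup H G" "card H = p ^ k"
  obtains g where "g \<in> carrier G" "H \<subseteq> conj_subgroup G P g"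
proof -
  have sP: "subgroup P G" and cP: "card P = p ^ multiplicity p (card (carrier G))"
    using P by (auto simp: sylow_subgroup_def)
  have Pc: "P \<subseteq> carrier G" and Hc: "H \<subseteq> carrier G" using sP H by (auto dest: subgroup.subset)
  let ?H = "G\<lparr>carrier := H\<rparr>"
  interpret H: group ?H using subgroup_imp_group[OF H(1)] .
  have invH: "inv\<^bsub>?H\<^esub> x = inv x" if "x \<in> H" for x using m_inv_consistent[OF H(1) that] .
  define E where "E = rcosets P"
  have finE: "finite E" unfolding E_def using fin by (simp add: RCOSETS_def)
  \<comment> \<open>The inverse turns right multiplication into a left action. The map is restricted
    to \<open>E\<close> because \<open>Bij E\<close> consists of extensional functions.\<close>
  define act where "act = (\<lambda>h. \<lambda>C\<in>E. C #> inv h)"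
  have Ec: "C \<subseteq> carrier G" if "C \<in> E" for C
    using that sP Pc unfolding E_def RCOSETS_def by (auto simp: r_coset_def)
  have EE: "C #> x \<in> E" if C: "C \<in> E" and x: "x \<in> carrier G" for C x
  proof -
    obtain a where a: "a \<in> carrier G" "C = P #> a" using C by (auto simp: E_def RCOSETS_def)
    then have "C #> x = P #> (a \<otimes> x)" using x Pc by (simp add: coset_mult_assoc)
    then show ?thesis using a x by (auto simp: E_def RCOSETS_def)
  qed
  have bij: "act h \<in> Bij E" if h: "h \<in> H" for h
  proof -
    have hc: "h \<in> carrier G" using h Hc by auto
    have "bij_betw (\<lambda>C. C #> inv h) E E"
      by (rule bij_betwI[of _ _ _ "\<lambda>C. C #> h"]) (use hc EE Ec in \<open>auto simp: coset_mult_assoc coset_mult_one\<close>)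
    then have "bij_betw (act h) E E"
      unfolding act_def by (subst bij_betw_cong[of _ _ "\<lambda>C. C #> inv h"]) auto
    then show ?thesis by (simp add: Bij_def act_def)
  qed
  have "act \<in> hom ?H (BijGroup E)"
  proof (rule homI)
    show "act x \<in> carrier (BijGroup E)" if "x \<in> carrier ?H" for x using bij that by (simp add: BijGroup_def)
    fix x y assume "x \<in> carrier ?H" "y \<in> carrier ?H"
    then have xy: "x \<in> H" "y \<in> H" "x \<in> carrier G" "y \<in> carrier G" using Hc by auto
    have "act (x \<otimes> y) = compose E (act x) (act y)"
    proof (rule ext)
      fix C
      show "act (x \<otimes> y) C = compose E (act x) (act y) C"
        using xy Ec[of C] EE[of C "inv y"] by (simp add: act_def compose_def inv_mult_group coset_mult_assoc)
    qed
    then show "act (x \<otimes>\<^bsub>?H\<^esub> y) = act x \<otimes>\<^bsub>BijGroup E\<^esub> act y"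
      using bij xy by (simp add: BijGroup_def)
  qed
  then interpret act: group_action ?H E act
    unfolding group_action_def group_hom_def group_hom_axioms_def using group_BijGroup H.group_axioms by blast
  have "\<exists>C\<in>E. card (orbit ?H act C) = 1"
  proof (rule ccontr)
    assume no: "\<not> (\<exists>C\<in>E. card (orbit ?H act C) = 1)"
    have dvd: "p dvd card (orbit ?H act C)" if C: "C \<in> E" for C
    proof -
      \<comment> \<open>Orbit sizes are powers of p, so without a fixed coset all of them are
        divisible by p.\<close>
      have "card (orbit ?H act C) dvd p ^ k"
        using act.orbit_stabilizer_theorem[OF C] H(2) by (simp add: Coset.order_def dvdI[of _ _ "card (stabilizer ?H act C)"])
      then obtain i where i: "card (orbit ?H act C) = p ^ i" using p by (auto simp: divides_primepow_nat)
      then have "i \<noteq> 0" using no C by (metis power_0)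
      then show ?thesis using i by simp
    qed
    interpret part: partition E "orbits ?H E act" by (rule act.orbit_partition)
    have finO: "finite (orbits ?H E act)" "\<And>C. C \<in> orbits ?H E act \<Longrightarrow> finite C"
      using part.partition_coverture finE by (metis finite_UnionD) (use part.incl finE in \<open>meson finite_subset\<close>)
    have "card E = (\<Sum>C\<in>orbits ?H E act. card C)"
      using disjoint_sum[OF finO(1) finE act.orbit_partition, of "\<lambda>_. 1::nat"] by simp
    moreover have "p dvd (\<Sum>C\<in>orbits ?H E act. card C)"
      by (rule dvd_sum) (use dvd in \<open>auto simp: orbits_def\<close>)
    ultimately have "p dvd card E" by simp
    moreover have "card E * card P = card (carrier G)" using lagrange[OF sP] by (simp add: E_def Coset.order_def)
    \<comment> \<open>If p divided the index of \<open>P\<close>, a higher power of p than the Sylow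
      order would divide the group order.\<close>
    ultimately have "p ^ Suc (multiplicity p (card (carrier G))) dvd card (carrier G)"
      using cP by (metis mult_dvd_mono dvd_refl power_Suc)
    moreover have "card (carrier G) \<noteq> 0" using fin by (metis card_0_eq empty_iff one_closed)
    ultimately show False using p by (metis multiplicity_geI Suc_n_not_le_n not_prime_unit)
  qed
  then obtain C where C: "C \<in> E" "card (orbit ?H act C) = 1" by auto
  have fixC: "act h C = C" if h: "h \<in> H" for h
  proof -
    have "C \<in> orbit ?H act C" using act.orbit_refl[OF C(1)] .
    moreover have "act h C \<in> orbit ?H act C" using h by (auto simp: orbit_def)
    ultimately show ?thesis using C(2) by (metis card_1_singletonE singletonD)
  qed
  obtain g where g: "g \<in> carrier G" "C = P #> g" using C(1) by (auto simp: E_def RCOSETS_def)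
  have "h \<in> conj_subgroup G P g" if h: "h \<in> H" for h
  proof -
    have hc: "h \<in> carrier G" using h Hc by auto
    have ih: "inv h \<in> H" using h H(1) by (simp add: subgroup.m_inv_closed)
    \<comment> \<open>For the fixed coset C = P g this says that g h lies in P g, so h = g^-1 x g
      for some x in P.\<close>
    have "C #> h = C" using fixC[OF ih] C(1) hc by (simp add: act_def)
    moreover have "g \<otimes> h \<in> C #> h" using rcos_self[OF g(1) sP] unfolding g(2)[symmetric] r_coset_def[of _ C h] by auto
    ultimately have "g \<otimes> h \<in> P #> g" using g by simp
    then obtain x where x: "x \<in> P" "g \<otimes> h = x \<otimes> g" by (auto simp: r_coset_def)
    have "conj_by g x = inv g \<otimes> (g \<otimes> h)" using x(2) g x(1) Pc by (simp add: conj_by_def m_assoc subset_iff)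
    also have "\<dots> = h" using g hc by (simp add: m_assoc[symmetric])
    finally show ?thesis using x(1) by (auto simp: conj_subgroup_image)
  qed
  then show thesis using that[OF g(1)] by blast
qed

end

section \<open>Counting components\<close>

lemma SpeD: "H \<in> Spe p e G \<Longrightarrow> subgroup H G"
  by (simp add: Spe_def)

lemma Spe_finite: "p > 0 \<Longrightarrow> H \<in> Spe p e G \<Longrightarrow> finite H"
  by (auto simp: Spe_def intro: card_ge_0_finite)

text \<open>\<open>Gamma_le\<close> overwrites the carrier before it forms an inner product, so the
  order on the poset of a subgroup is literally the order of the big poset.\<close>

lemma Gamma_le_carrier_update [simp]: "Gamma_le (G\<lparr>carrier := P\<rparr>) = Gamma_le G"
  by (simp add: Gamma_le_def)

lemma Irr_extensional: "\<phi> \<in> Irr G \<Longrightarrow> \<phi> \<in> extensional (carrier G)"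
  by (auto simp: Irr_def character_of_def)

lemma Gamma_extend:
  assumes G: "group G" and H: "subgroup H G" and K: "subgroup K G" "finite K" and "H \<subseteq> K"
    and "\<phi> \<in> Irr (G\<lparr>carrier := H\<rparr>)"
  shows "\<exists>\<psi>\<in>Irr (G\<lparr>carrier := K\<rparr>). Gamma_le G (H, \<phi>) (K, \<psi>)"
proof -
  have gK: "group (G\<lparr>carrier := K\<rparr>)" using group.subgroup_imp_group[OF G K(1)] .
  have "subgroup H (G\<lparr>carrier := K\<rparr>)" using group.subgroup_incl[OF G H K(1)] assms by simp
  then show ?thesis
    using Irr_extension_constituent[OF gK] K(2) assms(5,6) unfolding Gamma_le_def
    by (simp) (metis subsetD)
qed

lemma Gamma_restrict:
  assumes G: "group G" and H: "subgroup H G" and K: "subgroup K G" "finite K" and "H \<subseteq> K"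
    and "\<psi> \<in> Irr (G\<lparr>carrier := K\<rparr>)"
  shows "\<exists>\<phi>\<in>Irr (G\<lparr>carrier := H\<rparr>). Gamma_le G (H, \<phi>) (K, \<psi>)"
proof -
  have gK: "group (G\<lparr>carrier := K\<rparr>)" using group.subgroup_imp_group[OF G K(1)] .
  have sub: "subgroup H (G\<lparr>carrier := K\<rparr>)" using group.subgroup_incl[OF G H K(1)] assms by simp
  show ?thesis
    using Irr_restrict_constituent[OF gK _ sub assms(6)] K(2) assms(5) by (simp add: Gamma_le_def)
qed

text \<open>In a p-group the whole group lies above every \<open>H\<close>, so each component
  contains a pair (\<open>carrier G\<close>, \<open>\<psi>\<close>) with \<open>\<psi>\<close> among
  the constituents of the regular character.\<close>

lemma Gamma_finite_pi0:
  assumes G: "group G" "finite (carrier G)" and p: "p > 0" "card (carrier G) = p ^ k"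
  shows "finite (pi0 (Gamma_pe p e G) (Gamma_le G))"
proof -
  obtain X where X: "finite X" "X \<subseteq> Irr G"
    "\<And>H \<phi>. subgroup H G \<Longrightarrow> \<phi> \<in> Irr (G\<lparr>carrier := H\<rparr>) \<Longrightarrow>
       \<exists>\<psi>\<in>X. char_inner (G\<lparr>carrier := H\<rparr>) \<phi> (restrict \<psi> H) \<noteq> 0"
    using Irr_extension_constituent[OF G] by metis
  have "pi0 (Gamma_pe p e G) (Gamma_le G) \<subseteq>
     (\<lambda>\<psi>. poset_component (Gamma_pe p e G) (Gamma_le G) (carrier G, \<psi>)) ` X"
  proof
    fix C assume "C \<in> pi0 (Gamma_pe p e G) (Gamma_le G)"
    then obtain H \<phi> where H: "(H, \<phi>) \<in> Gamma_pe p e G" "C = poset_component (Gamma_pe p e G) (Gamma_le G) (H, \<phi>)"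
      by (auto simp: pi0_def)
    then have H': "subgroup H G" "card H > p ^ e" "\<phi> \<in> Irr (G\<lparr>carrier := H\<rparr>)" "H \<in> Spe p e G"
      by (auto simp: Gamma_pe_def Spe_def)
    obtain \<psi> where \<psi>: "\<psi> \<in> X" "char_inner (G\<lparr>carrier := H\<rparr>) \<phi> (restrict \<psi> H) \<noteq> 0" using X(3)[OF H'(1,3)] by auto
    have "card H \<le> card (carrier G)" using H'(1) G(2) by (simp add: card_mono subgroup.subset)
    then have "carrier G \<in> Spe p e G" using H'(2) p group.subgroup_self[OF G(1)] by (auto simp: Spe_def)
    then have G': "(carrier G, \<psi>) \<in> Gamma_pe p e G" using \<psi>(1) X(2) by (auto simp: Gamma_pe_def)
    have "Gamma_le G (H, \<phi>) (carrier G, \<psi>)" using \<psi>(2) H'(1) by (simp add: Gamma_le_def subgroup.subset)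
    then have "poset_conn (Gamma_pe p e G) (Gamma_le G) (H, \<phi>) (carrier G, \<psi>)"
      using H(1) G' by (intro poset_conn_step) auto
    then have "C = poset_component (Gamma_pe p e G) (Gamma_le G) (carrier G, \<psi>)"
      using H G' poset_component_eq_iff by metis
    then show "C \<in> (\<lambda>\<psi>. poset_component (Gamma_pe p e G) (Gamma_le G) (carrier G, \<psi>)) ` X" using \<psi>(1) by auto
  qed
  then show ?thesis using X(1) by (meson finite_imageI finite_subset)
qed

locale finite_group_sylow = group G for G (structure) +
  fixes P :: "'a set" and p e :: nat
  assumes fin: "finite (carrier G)" and prime: "prime p" and sylow: "sylow_subgroup p G P"
begin

abbreviation "\<S> \<equiv> Spe p e G"
abbreviation "\<Gamma> \<equiv> Gamma_pe p e G"

lemma sP: "subgroup P G" and cP: "card P = p ^ multiplicity p (card (carrier G))"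
  using sylow by (auto simp: sylow_subgroup_def)

lemma Pc: "P \<subseteq> carrier G" by (rule subgroup.subset[OF sP])

lemma p_pos: "p > 0" using prime prime_gt_0_nat by auto

lemma Spe_conj_closed: "H \<in> \<S> \<Longrightarrow> g \<in> carrier G \<Longrightarrow> conj_subgroup G H g \<in> \<S>"
  by (auto simp: Spe_def conj_subgroup_subgroup conj_subgroup_card subgroup.subset)

lemma Spe_sylow:
  assumes "H \<in> \<S>"
  shows "P \<in> \<S>" "\<exists>g\<in>carrier G. H \<subseteq> conj_subgroup G P g"
proof -
  obtain k where H: "subgroup H G" "card H = p ^ k" "card H > p ^ e" using assms by (auto simp: Spe_def)
  obtain g where g: "g \<in> carrier G" "H \<subseteq> conj_subgroup G P g" using sylow_conj_contains[OF fin prime sylow H(1,2)] .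
  have "finite (conj_subgroup G P g)" using conj_subgroup_subgroup[OF sP g(1)] fin subgroup.subset finite_subset by metis
  then have "card H \<le> card P" using g conj_subgroup_card[OF Pc g(1)] card_mono by metis
  then show "P \<in> \<S>" using H sP cP by (auto simp: Spe_def)
  show "\<exists>g\<in>carrier G. H \<subseteq> conj_subgroup G P g" using g by auto
qed

lemma Spe_conj_conn:
  assumes "poset_conn \<S> (\<subseteq>) H K" "g \<in> carrier G"
  shows "poset_conn \<S> (\<subseteq>) (conj_subgroup G H g) (conj_subgroup G K g)"
  using assms(1) by (rule poset_conn_image) (use assms(2) Spe_conj_closed in \<open>auto simp: conj_subgroup_image\<close>)

text \<open>Every member lies inside a conjugate of \<open>P\<close>, hence in the component of that
  conjugate. If \<open>P\<close> itself fails the size bound, there are no members at all.\<close>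

lemma Spe_pi0_conj: "pi0 \<S> (\<subseteq>) = (if P \<in> \<S> then (\<lambda>g. poset_component \<S> (\<subseteq>) (conj_subgroup G P g)) ` carrier G else {})"
proof (cases "P \<in> \<S>")
  case True
  have "poset_component \<S> (\<subseteq>) H \<in> (\<lambda>g. poset_component \<S> (\<subseteq>) (conj_subgroup G P g)) ` carrier G" if H: "H \<in> \<S>" for H
  proof -
    obtain g where g: "g \<in> carrier G" "H \<subseteq> conj_subgroup G P g" using Spe_sylow(2)[OF H] by auto
    have "poset_conn \<S> (\<subseteq>) H (conj_subgroup G P g)"
      by (rule poset_conn_step) (use H g True Spe_conj_closed in auto)
    then show ?thesis using g poset_conn_in poset_component_eq_iff by (metis (no_types, lifting) image_eqI)
  qed
  then show ?thesis using True Spe_conj_closed[OF True] by (auto simp: pi0_def)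
next
  case False
  then show ?thesis using Spe_sylow(1) by (auto simp: pi0_def)
qed

lemma finite_pi0_Spe: "finite (pi0 \<S> (\<subseteq>))"
  using fin by (simp add: Spe_pi0_conj)

text \<open>The conjugate character sends x to phi(g x g^-1). It is restricted to the conjugate
  subgroup because members of \<open>Irr\<close> are extensional.\<close>

definition gamma_conj :: "'a \<Rightarrow> 'a set \<times> ('a \<Rightarrow> complex) \<Rightarrow> 'a set \<times> ('a \<Rightarrow> complex)" where
  "gamma_conj g = (\<lambda>(H, \<phi>). (conj_subgroup G H g, restrict (\<phi> \<circ> conj_by (inv g)) (conj_subgroup G H g)))"

lemma fst_gamma_conj [simp]: "fst (gamma_conj g x) = conj_subgroup G (fst x) g"
  by (simp add: gamma_conj_def case_prod_beta)

lemma gamma_conj_closed: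
  assumes x: "x \<in> \<Gamma>" and g: "g \<in> carrier G"
  shows "gamma_conj g x \<in> \<Gamma>"
proof -
  obtain H \<phi> where x': "x = (H, \<phi>)" by (cases x)
  have H: "H \<in> \<S>" "\<phi> \<in> Irr (G\<lparr>carrier := H\<rparr>)" using x x' by (auto simp: Gamma_pe_def)
  let ?K = "conj_subgroup G H g"
  have Hc: "H \<subseteq> carrier G" using SpeD[OF H(1)] by (rule subgroup.subset)
  have K: "?K \<in> \<S>" using Spe_conj_closed[OF H(1) g] .
  have Kc: "?K \<subseteq> carrier G" using SpeD[OF K] by (rule subgroup.subset)
  have im: "conj_by (inv g) ` ?K = H"
    unfolding conj_subgroup_image[symmetric]
    using conj_subgroup_conj_subgroup[OF Hc g, of "inv g"] g Hc by (simp add: conj_subgroup_one)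
  have "conj_by (inv g) \<in> iso (G\<lparr>carrier := ?K\<rparr>) (G\<lparr>carrier := H\<rparr>)"
    unfolding iso_def hom_def bij_betw_def
    using im Kc g conj_by_inj[of "inv g"] by (auto simp: conj_by_mult subset_iff intro: inj_on_subset)
  from Irr_iso[OF _ _ this H(2)] show ?thesis
    using K subgroup_imp_group[OF SpeD[OF K]] subgroup_imp_group[OF SpeD[OF H(1)]]
    by (simp add: x' gamma_conj_def Gamma_pe_def)
qed

lemma gamma_conj_inv:
  assumes x: "x \<in> \<Gamma>" and g: "g \<in> carrier G"
  shows "gamma_conj (inv g) (gamma_conj g x) = x"
proof -
  obtain H \<phi> where x': "x = (H, \<phi>)" by (cases x)
  have H: "H \<in> \<S>" "\<phi> \<in> Irr (G\<lparr>carrier := H\<rparr>)" using x x' by (auto simp: Gamma_pe_def)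
  have Hc: "H \<subseteq> carrier G" using SpeD[OF H(1)] by (rule subgroup.subset)
  have e: "conj_subgroup G (conj_subgroup G H g) (inv g) = H"
    using conj_subgroup_conj_subgroup[OF Hc g, of "inv g"] g Hc by (simp add: conj_subgroup_one)
  have "restrict (restrict (\<phi> \<circ> conj_by (inv g)) (conj_subgroup G H g) \<circ> conj_by (inv (inv g))) H = \<phi>"
  proof (rule extensionalityI[of _ H])
    show "\<phi> \<in> extensional H" using Irr_extensional[OF H(2)] by simp
    fix y assume y: "y \<in> H"
    then have "conj_by g y \<in> conj_subgroup G H g" by (simp add: conj_subgroup_image)
    then show "restrict (restrict (\<phi> \<circ> conj_by (inv g)) (conj_subgroup G H g) \<circ> conj_by (inv (inv g))) H y = \<phi> y"
      using y Hc g by (simp add: subset_iff)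
  qed simp
  then show ?thesis by (simp add: x' gamma_conj_def e)
qed

lemma gamma_conj_mono:
  assumes x: "x \<in> \<Gamma>" and y: "y \<in> \<Gamma>" and g: "g \<in> carrier G" and le: "Gamma_le G x y"
  shows "Gamma_le G (gamma_conj g x) (gamma_conj g y)"
proof -
  obtain H \<phi> K \<psi> where xy: "x = (H, \<phi>)" "y = (K, \<psi>)" by (cases x, cases y)
  have H: "H \<in> \<S>" and HK: "H \<subseteq> K" and ne: "char_inner (G\<lparr>carrier := H\<rparr>) \<phi> (restrict \<psi> H) \<noteq> 0"
    using x le xy by (auto simp: Gamma_pe_def Gamma_le_def)
  have Hc: "H \<subseteq> carrier G" using SpeD[OF H] by (rule subgroup.subset)
  have sub: "conj_subgroup G H g \<subseteq> conj_subgroup G K g" using HK by (auto simp: conj_subgroup_image)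
  have bij: "bij_betw (conj_by g) H (conj_subgroup G H g)"
    unfolding conj_subgroup_image bij_betw_def using conj_by_inj[OF g] Hc by (auto intro: inj_on_subset)
  have "(\<Sum>z\<in>conj_subgroup G H g. restrict (\<phi> \<circ> conj_by (inv g)) (conj_subgroup G H g) z *
          cnj (restrict (restrict (\<psi> \<circ> conj_by (inv g)) (conj_subgroup G K g)) (conj_subgroup G H g) z))
      = (\<Sum>z\<in>conj_subgroup G H g. \<phi> (conj_by (inv g) z) * cnj (\<psi> (conj_by (inv g) z)))"
    by (rule sum.cong) (use sub in auto)
  also have "\<dots> = (\<Sum>z\<in>H. \<phi> z * cnj (\<psi> z))"
    unfolding sum.reindex_bij_betw[OF bij, symmetric] by (rule sum.cong) (use Hc g in auto)
  finally show ?thesis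
    using ne sub conj_subgroup_card[OF Hc g]
    by (simp add: xy gamma_conj_def Gamma_le_def char_inner_def)
qed

lemma X_conn_sylow:
  assumes "poset_conn \<S> (\<subseteq>) H P" and "\<phi> \<in> Irr (G\<lparr>carrier := H\<rparr>)"
  shows "\<exists>\<psi>\<in>Irr (G\<lparr>carrier := P\<rparr>). poset_conn (X_pe p e G P) (Gamma_le G) (H, \<phi>) (P, \<psi>)"
proof -
  have PS: "P \<in> \<S>" using poset_conn_in[OF assms(1)] by simp
  have X: "(K, \<psi>) \<in> X_pe p e G P" if "poset_conn \<S> (\<subseteq>) K P" "\<psi> \<in> Irr (G\<lparr>carrier := K\<rparr>)" for K \<psi>
    using that poset_conn_in[OF that(1)] by (simp add: X_pe_def Gamma_pe_def)
  have "(\<lambda>a b. a \<in> \<S> \<and> b \<in> \<S> \<and> (a \<subseteq> b \<or> b \<subseteq> a))\<^sup>*\<^sup>* H P" using assms(1) by (simp add: poset_conn_def)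
  \<comment> \<open>The claim ranges over all characters, since each step of the path changes the
    character. It also carries connectedness of \<open>H\<close> to \<open>P\<close>, so that the
    lifted points lie in X(P).\<close>
  then have "poset_conn \<S> (\<subseteq>) H P \<and> (\<forall>\<phi>\<in>Irr (G\<lparr>carrier := H\<rparr>).
     \<exists>\<psi>\<in>Irr (G\<lparr>carrier := P\<rparr>). poset_conn (X_pe p e G P) (Gamma_le G) (H, \<phi>) (P, \<psi>))"
  proof (induct rule: converse_rtranclp_induct)
    case base
    have "poset_conn \<S> (\<subseteq>) P P" using PS by (rule poset_conn_refl)
    then show ?case using X poset_conn_refl by metis
  next
    case (step H K)
    have cH: "poset_conn \<S> (\<subseteq>) H P"
      by (rule poset_conn_trans[OF poset_conn_step[of H _ K]]) (use step in auto)
    have HK: "subgroup H G" "finite H" "subgroup K G" "finite K"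
      using step SpeD Spe_finite[OF p_pos] by blast+
    show ?case
    proof (intro conjI ballI cH)
      fix \<phi> assume \<phi>: "\<phi> \<in> Irr (G\<lparr>carrier := H\<rparr>)"
      have "\<exists>\<phi>'\<in>Irr (G\<lparr>carrier := K\<rparr>). Gamma_le G (H, \<phi>) (K, \<phi>') \<or> Gamma_le G (K, \<phi>') (H, \<phi>)"
        using step(1) Gamma_extend[OF is_group HK(1,3,4) _ \<phi>] Gamma_restrict[OF is_group HK(3,1,2) _ \<phi>] by blast
      then obtain \<phi>' where \<phi>': "\<phi>' \<in> Irr (G\<lparr>carrier := K\<rparr>)" "Gamma_le G (H, \<phi>) (K, \<phi>') \<or> Gamma_le G (K, \<phi>') (H, \<phi>)"
        by auto
      have "poset_conn (X_pe p e G P) (Gamma_le G) (H, \<phi>) (K, \<phi>')"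
        by (rule poset_conn_step) (use X[OF cH \<phi>] X[OF _ \<phi>'(1)] step(3) \<phi>'(2) in auto)
      moreover obtain \<psi> where "\<psi> \<in> Irr (G\<lparr>carrier := P\<rparr>)" "poset_conn (X_pe p e G P) (Gamma_le G) (K, \<phi>') (P, \<psi>)"
        using step(3) \<phi>'(1) by auto
      ultimately show "\<exists>\<psi>\<in>Irr (G\<lparr>carrier := P\<rparr>). poset_conn (X_pe p e G P) (Gamma_le G) (H, \<phi>) (P, \<psi>)"
        using poset_conn_trans by metis
    qed
  qed
  then show ?thesis using assms(2) by blast
qed

lemma Spe_sylow_subset: "Spe p e (G\<lparr>carrier := P\<rparr>) \<subseteq> {H \<in> \<S>. H \<subseteq> P}"
  using incl_subgroup[OF sP] subgroup.subset by (fastforce simp: Spe_def)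

text \<open>The inclusion of the pairs over subgroups of \<open>P\<close> meets every component of
  X(P), because each pair of X(P) is joined to one over \<open>P\<close>. The finiteness half is
  used again in the product formula.\<close>

lemma pi0_X_le:
  "finite (pi0 (X_pe p e G P) (Gamma_le G)) \<and> card (pi0 (X_pe p e G P) (Gamma_le G))
     \<le> card (pi0 (Gamma_pe p e (G\<lparr>carrier := P\<rparr>)) (Gamma_le (G\<lparr>carrier := P\<rparr>)))"
proof (rule pi0_card_surj[where f = "\<lambda>x. x"])
  have gP: "group (G\<lparr>carrier := P\<rparr>)" using subgroup_imp_group[OF sP] .
  show "finite (pi0 (Gamma_pe p e (G\<lparr>carrier := P\<rparr>)) (Gamma_le (G\<lparr>carrier := P\<rparr>)))"
    by (rule Gamma_finite_pi0[OF gP _ p_pos]) (use finite_subset[OF Pc fin] cP in auto)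
  show "a \<in> X_pe p e G P" if a: "a \<in> Gamma_pe p e (G\<lparr>carrier := P\<rparr>)" for a
  proof -
    obtain H \<phi> where H: "a = (H, \<phi>)" "H \<in> \<S>" "H \<subseteq> P" "\<phi> \<in> Irr (G\<lparr>carrier := H\<rparr>)"
      using a Spe_sylow_subset by (auto simp: Gamma_pe_def)
    have "poset_conn \<S> (\<subseteq>) H P"
      by (rule poset_conn_step) (use H Spe_sylow(1) in auto)
    then show ?thesis using H by (simp add: X_pe_def Gamma_pe_def)
  qed
  show "Gamma_le G a b" if "Gamma_le (G\<lparr>carrier := P\<rparr>) a b" for a b using that by simp
  show "\<exists>a\<in>Gamma_pe p e (G\<lparr>carrier := P\<rparr>). poset_conn (X_pe p e G P) (Gamma_le G) a b"
    if b: "b \<in> X_pe p e G P" for b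
  proof -
    obtain H \<phi> where H: "b = (H, \<phi>)" "poset_conn \<S> (\<subseteq>) H P" "\<phi> \<in> Irr (G\<lparr>carrier := H\<rparr>)"
      using b by (auto simp: X_pe_def Gamma_pe_def)
    obtain \<psi> where \<psi>: "\<psi> \<in> Irr (G\<lparr>carrier := P\<rparr>)" "poset_conn (X_pe p e G P) (Gamma_le G) (H, \<phi>) (P, \<psi>)"
      using X_conn_sylow[OF H(2,3)] by auto
    have "P \<in> \<S>" using poset_conn_in[OF H(2)] by simp
    then have "P \<in> Spe p e (G\<lparr>carrier := P\<rparr>)" using group.subgroup_self[OF gP] by (simp add: Spe_def)
    then have "(P, \<psi>) \<in> Gamma_pe p e (G\<lparr>carrier := P\<rparr>)" using \<psi>(1) by (simp add: Gamma_pe_def)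
    then show ?thesis using poset_conn_sym[OF \<psi>(2)] H(1) by auto
  qed
qed

text \<open>This presents X(P) as a preimage under the projection to subgroups, the shape that
  \<open>pi0_card_fibres\<close> works with.\<close>

lemma X_pe_alt: "X_pe p e G P = {x \<in> \<Gamma>. fst x \<in> poset_component \<S> (\<subseteq>) P}"
  unfolding X_pe_def poset_component_def using poset_conn_sym by fastforce

lemma card_pi0_Gamma:
  "card (pi0 \<Gamma> (Gamma_le G)) = card (pi0 (X_pe p e G P) (Gamma_le G)) * card (pi0 \<S> (\<subseteq>))"
proof (rule pi0_card_fibres[where f = fst])
  show "finite (pi0 \<S> (\<subseteq>))" by (rule finite_pi0_Spe)
  show "fst a \<in> \<S>" if "a \<in> \<Gamma>" for a using that by (auto simp: Gamma_pe_def)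
  show "fst a \<subseteq> fst b" if "Gamma_le G a b" for a b using that by (auto simp: Gamma_le_def)
  fix C assume "C \<in> pi0 \<S> (\<subseteq>)"
  then obtain g where g: "g \<in> carrier G" and C: "C = poset_component \<S> (\<subseteq>) (conj_subgroup G P g)"
    by (auto simp: Spe_pi0_conj split: if_splits)
  have PP: "conj_subgroup G (conj_subgroup G P g) (inv g) = P"
    using conj_subgroup_conj_subgroup[OF Pc g, of "inv g"] g Pc by (simp add: conj_subgroup_one)
  show "finite (pi0 {a \<in> \<Gamma>. fst a \<in> C} (Gamma_le G)) \<and>
     card (pi0 {a \<in> \<Gamma>. fst a \<in> C} (Gamma_le G)) = card (pi0 (X_pe p e G P) (Gamma_le G))"
  proof (rule pi0_card_iso[where f = "gamma_conj g" and h = "gamma_conj (inv g)"])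
    show "finite (pi0 (X_pe p e G P) (Gamma_le G))" using pi0_X_le by simp
    show "gamma_conj g a \<in> {a \<in> \<Gamma>. fst a \<in> C}" if "a \<in> X_pe p e G P" for a
      using that g gamma_conj_closed Spe_conj_conn by (auto simp: X_pe_alt C poset_component_def)
    show "gamma_conj (inv g) b \<in> X_pe p e G P" if b: "b \<in> {a \<in> \<Gamma>. fst a \<in> C}" for b
      using b g gamma_conj_closed[of b "inv g"] Spe_conj_conn[of "conj_subgroup G P g" "fst b" "inv g"]
      by (simp add: X_pe_alt C poset_component_def PP)
    show "Gamma_le G (gamma_conj g a) (gamma_conj g b)"
      if "a \<in> X_pe p e G P" "b \<in> X_pe p e G P" "Gamma_le G a b" for a b
      using that g gamma_conj_mono by (simp add: X_pe_alt)
    show "Gamma_le G (gamma_conj (inv g) a) (gamma_conj (inv g) b)"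
      if "a \<in> {a \<in> \<Gamma>. fst a \<in> C}" "b \<in> {a \<in> \<Gamma>. fst a \<in> C}" "Gamma_le G a b" for a b
      using that g gamma_conj_mono by simp
    show "gamma_conj g (gamma_conj (inv g) b) = b" if "b \<in> {a \<in> \<Gamma>. fst a \<in> C}" for b
      using that g gamma_conj_inv[of b "inv g"] by simp
    show "gamma_conj (inv g) (gamma_conj g a) = a" if "a \<in> X_pe p e G P" for a
      using that g gamma_conj_inv by (simp add: X_pe_alt)
  qed
qed

section \<open>The stabilizer of a component and the index formula\<close>

lemma comp_stabilizer_iff:
  assumes "P \<in> \<S>" "g \<in> carrier G"
  shows "g \<in> comp_stabilizer p e G P \<longleftrightarrow> poset_conn \<S> (\<subseteq>) (conj_subgroup G P g) P"
  using assms Spe_conj_closed by (simp add: comp_stabilizer_def poset_component_eq_iff)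

text \<open>Conjugation by h^-1 preserves connectedness and carries the pair P^g, P^h to P^(g h^-1),
  P; conjugation by h goes back. Thus components match right cosets of the stabilizer.\<close>

lemma conj_conn_iff:
  assumes P: "P \<in> \<S>" and g: "g \<in> carrier G" and h: "h \<in> carrier G"
  shows "poset_conn \<S> (\<subseteq>) (conj_subgroup G P g) (conj_subgroup G P h) \<longleftrightarrow> g \<otimes> inv h \<in> comp_stabilizer p e G P"
proof -
  have c: "conj_subgroup G P a \<subseteq> carrier G" if "a \<in> carrier G" for a
    using subgroup.subset[OF conj_subgroup_subgroup[OF sP that]] .
  have e: "conj_subgroup G (conj_subgroup G P g) (inv h) = conj_subgroup G P (g \<otimes> inv h)"
    "conj_subgroup G (conj_subgroup G P h) (inv h) = P"
    "conj_subgroup G (conj_subgroup G P (g \<otimes> inv h)) h = conj_subgroup G P g"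
    using g h Pc by (simp_all add: conj_subgroup_conj_subgroup conj_subgroup_one m_assoc)
  show ?thesis
    using comp_stabilizer_iff[OF P, of "g \<otimes> inv h"] g h e
      Spe_conj_conn[of "conj_subgroup G P g" "conj_subgroup G P h" "inv h"]
      Spe_conj_conn[of "conj_subgroup G P (g \<otimes> inv h)" P h]
    by auto
qed

text \<open>Through \<open>conj_conn_iff\<close>, closure under inverses and products becomes
  symmetry and transitivity of connectedness.\<close>

lemma comp_stabilizer_subgroup:
  assumes P: "P \<in> \<S>"
  shows "subgroup (comp_stabilizer p e G P) G"
proof (rule subgroupI)
  show sub: "comp_stabilizer p e G P \<subseteq> carrier G" by (auto simp: comp_stabilizer_def)
  have "\<one> \<in> comp_stabilizer p e G P" using Pc by (simp add: comp_stabilizer_def conj_subgroup_one)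
  then show "comp_stabilizer p e G P \<noteq> {}" by auto
  have conn1: "poset_conn \<S> (\<subseteq>) (conj_subgroup G P g) (conj_subgroup G P \<one>)" if "g \<in> comp_stabilizer p e G P" for g
    using that sub conj_conn_iff[OF P, of g \<one>] by auto
  show inv: "inv a \<in> comp_stabilizer p e G P" if a: "a \<in> comp_stabilizer p e G P" for a
    using conj_conn_iff[OF P, of \<one> a] poset_conn_sym[OF conn1[OF a]] a sub by auto
  fix a b assume a: "a \<in> comp_stabilizer p e G P" and b: "b \<in> comp_stabilizer p e G P"
  \<comment> \<open>The partner is \<open>inv b\<close> because the criterion inverts its second
    argument, and \<open>a \<otimes> inv (inv b)\<close> is the desired product.\<close>
  have "poset_conn \<S> (\<subseteq>) (conj_subgroup G P a) (conj_subgroup G P (inv b))"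
    by (rule poset_conn_trans[OF conn1[OF a] poset_conn_sym[OF conn1[OF inv[OF b]]]])
  then show "a \<otimes> b \<in> comp_stabilizer p e G P" using conj_conn_iff[OF P, of a "inv b"] subsetD[OF sub a] subsetD[OF sub b] by simp
qed

lemma card_pi0_Spe:
  assumes P: "P \<in> \<S>"
  shows "card (pi0 \<S> (\<subseteq>)) = card (rcosets (comp_stabilizer p e G P))"
proof -
  let ?S = "comp_stabilizer p e G P"
  note sub = comp_stabilizer_subgroup[OF P]
  have r: "rcosets ?S = (\<lambda>g. ?S #> g) ` carrier G" by (auto simp: RCOSETS_def)
  have pi: "pi0 \<S> (\<subseteq>) = (\<lambda>g. poset_component \<S> (\<subseteq>) (conj_subgroup G P g)) ` carrier G"
    using P by (simp add: Spe_pi0_conj)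
  have eq: "?S #> g = ?S #> h \<longleftrightarrow>
     poset_component \<S> (\<subseteq>) (conj_subgroup G P g) = poset_component \<S> (\<subseteq>) (conj_subgroup G P h)"
    if gh: "g \<in> carrier G" "h \<in> carrier G" for g h
  proof -
    have "?S #> g = ?S #> h \<longleftrightarrow> g \<otimes> inv h \<in> ?S"
    proof
      assume "?S #> g = ?S #> h"
      then have "g \<in> ?S #> h" using rcos_self[OF gh(1) sub] by simp
      then obtain s where "s \<in> ?S" "g = s \<otimes> h" by (auto simp: r_coset_def)
      then show "g \<otimes> inv h \<in> ?S" using gh subgroup.mem_carrier[OF sub] by (simp add: m_assoc)
    next
      assume s: "g \<otimes> inv h \<in> ?S"
      have "g = (g \<otimes> inv h) \<otimes> h" using gh by (simp add: m_assoc)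
      then have "g \<in> ?S #> h" using s unfolding r_coset_def by blast
      then show "?S #> g = ?S #> h" using repr_independence[OF _ gh(2) sub] by simp
    qed
    then show ?thesis using conj_conn_iff[OF P gh] Spe_conj_closed[OF P] gh
      by (simp add: poset_component_eq_iff)
  qed
  \<comment> \<open>Both sets are images of the carrier under maps that identify the same elements,
    so each is at most as large as the other.\<close>
  have "card (pi0 \<S> (\<subseteq>)) \<le> card (rcosets ?S)" "card (rcosets ?S) \<le> card (pi0 \<S> (\<subseteq>))"
    unfolding r pi
    by (rule conjunct2[OF card_image_coarser]; use fin eq in \<open>simp; fail\<close>)+
  then show ?thesis by simp
qed

end

section \<open>Abelian subgroups and connectedness\<close>

lemma Spe_powerI:
  assumes "prime p" "subgroup Q G" "card Q = p ^ m" "e < m"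
  shows "Q \<in> Spe p e G"
proof -
  have "p ^ e < p ^ m" using assms(1,4) prime_gt_1_nat by (intro power_strict_increasing) auto
  then show ?thesis using assms by (auto simp: Spe_def)
qed

lemma trivial_character_Irr:
  assumes "group G"
  shows "restrict (\<lambda>_. 1) (carrier G) \<in> Irr G"
  by (rule linear_character_Irr[OF assms]) auto

text \<open>The two characters have the same restriction to \<open>A\<close>, so a constituent of
  this restriction lies below both.\<close>

lemma Gamma_conn_of_agree:
  assumes G: "group G" "finite (carrier G)" and Q: "Q \<in> Spe p e G" and A: "A \<in> Spe p e G" "A \<subseteq> Q"
    and \<chi>: "\<chi>1 \<in> Irr (G\<lparr>carrier := Q\<rparr>)" "\<chi>2 \<in> Irr (G\<lparr>carrier := Q\<rparr>)" and agree: "\<And>x. x \<in> A \<Longrightarrow> \<chi>1 x = \<chi>2 x"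
  shows "poset_conn (Gamma_pe p e G) (Gamma_le G) (Q, \<chi>1) (Q, \<chi>2)"
proof -
  have finQ: "finite Q" using subgroup.subset[OF SpeD[OF Q]] G(2) finite_subset by blast
  obtain \<alpha> where \<alpha>: "\<alpha> \<in> Irr (G\<lparr>carrier := A\<rparr>)" "Gamma_le G (A, \<alpha>) (Q, \<chi>1)"
    using Gamma_restrict[OF G(1) SpeD[OF A(1)] SpeD[OF Q] finQ A(2) \<chi>(1)] by auto
  have "restrict \<chi>1 A = restrict \<chi>2 A" using agree by (auto simp: restrict_def)
  then have \<alpha>2: "Gamma_le G (A, \<alpha>) (Q, \<chi>2)" using \<alpha>(2) by (simp add: Gamma_le_def)
  have in\<Gamma>: "(A, \<alpha>) \<in> Gamma_pe p e G" "(Q, \<chi>1) \<in> Gamma_pe p e G" "(Q, \<chi>2) \<in> Gamma_pe p e G"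
    using A Q \<chi> \<alpha>(1) by (auto simp: Gamma_pe_def)
  have "poset_conn (Gamma_pe p e G) (Gamma_le G) (Q, \<chi>1) (A, \<alpha>)"
    by (rule poset_conn_step) (use in\<Gamma> \<alpha>(2) in auto)
  moreover have "poset_conn (Gamma_pe p e G) (Gamma_le G) (A, \<alpha>) (Q, \<chi>2)"
    by (rule poset_conn_step) (use in\<Gamma> \<alpha>2 in auto)
  ultimately show ?thesis by (rule poset_conn_trans)
qed

text \<open>Any pair can be moved up to the whole p-group and from there down to \<open>Q\<close>,
  so connectedness only has to be checked among the characters of one subgroup
  \<open>Q\<close>.\<close>

lemma Gamma_connected_of_conn:
  assumes G: "group G" "finite (carrier G)" and p: "card (carrier G) = p ^ k"
    and Q: "Q \<in> Spe p e G" and \<theta>: "\<theta> \<in> Irr (G\<lparr>carrier := Q\<rparr>)"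
    and conn: "\<And>\<psi>. \<psi> \<in> Irr (G\<lparr>carrier := Q\<rparr>) \<Longrightarrow> poset_conn (Gamma_pe p e G) (Gamma_le G) (Q, \<psi>) (Q, \<theta>)"
  shows "poset_connected (Gamma_pe p e G) (Gamma_le G)"
proof -
  have self: "subgroup (carrier G) G" using group.subgroup_self[OF G(1)] .
  have "card Q \<le> card (carrier G)" using subgroup.subset[OF SpeD[OF Q]] G(2) by (simp add: card_mono)
  then have top: "carrier G \<in> Spe p e G" using Q self p by (auto simp: Spe_def)
  have finS: "finite H" "subgroup H G" "H \<subseteq> carrier G" if "H \<in> Spe p e G" for H
    using SpeD[OF that] subgroup.subset[OF SpeD[OF that]] G(2) finite_subset by blast+
  have Q\<Gamma>: "(Q, \<theta>) \<in> Gamma_pe p e G" using Q \<theta> by (simp add: Gamma_pe_def)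
  have all: "poset_conn (Gamma_pe p e G) (Gamma_le G) x (Q, \<theta>)" if x: "x \<in> Gamma_pe p e G" for x
  proof -
    obtain H \<phi> where H: "x = (H, \<phi>)" "H \<in> Spe p e G" "\<phi> \<in> Irr (G\<lparr>carrier := H\<rparr>)" using x by (auto simp: Gamma_pe_def)
    obtain \<psi> where \<psi>: "\<psi> \<in> Irr (G\<lparr>carrier := carrier G\<rparr>)" "Gamma_le G (H, \<phi>) (carrier G, \<psi>)"
      using Gamma_extend[OF G(1) finS(2)[OF H(2)] self G(2) finS(3)[OF H(2)] H(3)] by auto
    obtain \<psi>' where \<psi>': "\<psi>' \<in> Irr (G\<lparr>carrier := Q\<rparr>)" "Gamma_le G (Q, \<psi>') (carrier G, \<psi>)"
      using Gamma_restrict[OF G(1) finS(2)[OF Q] self G(2) finS(3)[OF Q] \<psi>(1)] by auto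
    have in\<Gamma>: "(carrier G, \<psi>) \<in> Gamma_pe p e G" "(Q, \<psi>') \<in> Gamma_pe p e G"
      using top Q \<psi>(1) \<psi>'(1) by (auto simp: Gamma_pe_def)
    have "poset_conn (Gamma_pe p e G) (Gamma_le G) x (carrier G, \<psi>)"
      by (rule poset_conn_step) (use x in\<Gamma> \<psi>(2) H(1) in auto)
    moreover have "poset_conn (Gamma_pe p e G) (Gamma_le G) (carrier G, \<psi>) (Q, \<psi>')"
      by (rule poset_conn_step) (use in\<Gamma> \<psi>'(2) in auto)
    ultimately show ?thesis using conn[OF \<psi>'(1)] poset_conn_trans by metis
  qed
  show ?thesis unfolding poset_connected_def
  proof (rule ex1I[of _ "poset_component (Gamma_pe p e G) (Gamma_le G) (Q, \<theta>)"])
    show "poset_component (Gamma_pe p e G) (Gamma_le G) (Q, \<theta>) \<in> pi0 (Gamma_pe p e G) (Gamma_le G)"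
      using Q\<Gamma> by (simp add: pi0_def)
    fix C assume "C \<in> pi0 (Gamma_pe p e G) (Gamma_le G)"
    then obtain x where x: "x \<in> Gamma_pe p e G" "C = poset_component (Gamma_pe p e G) (Gamma_le G) x"
      by (auto simp: pi0_def)
    then show "C = poset_component (Gamma_pe p e G) (Gamma_le G) (Q, \<theta>)"
      using all[OF x(1)] poset_component_eq_iff[OF x(1) Q\<Gamma>] by metis
  qed
qed

lemma linear_kernel_subgroup:
  fixes Q (structure)
  assumes Q: "group Q" and \<mu>: "\<mu> \<one> = (1::complex)"
    "\<And>x y. x \<in> carrier Q \<Longrightarrow> y \<in> carrier Q \<Longrightarrow> \<mu> (x \<otimes> y) = \<mu> x * \<mu> y"
  shows "subgroup {x \<in> carrier Q. \<mu> x = 1} Q"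
proof -
  interpret group Q by fact
  show ?thesis
  proof (rule subgroupI)
    fix a assume a: "a \<in> {x \<in> carrier Q. \<mu> x = 1}"
    then have "\<mu> (inv a) * \<mu> a = 1" using \<mu>(1) \<mu>(2)[of "inv a" a] by simp
    then show "inv a \<in> {x \<in> carrier Q. \<mu> x = 1}" using a by simp
  qed (use \<mu> in auto)
qed

text \<open>A linear character of an elementary abelian \<open>p\<close>-group takes at most \<open>p\<close> values.\<close>

lemma elementary_abelian_kernel_card:
  fixes Q (structure)
  assumes Q: "elementary_abelian p Q" "finite (carrier Q)" and p: "p > 0" and \<mu>: "\<mu> \<in> Irr Q"
  shows "card (carrier Q) \<le> p * card {x \<in> carrier Q. \<mu> x = 1}"
proof -
  have cQ: "comm_group Q" and exp: "\<And>x. x \<in> carrier Q \<Longrightarrow> x [^] p = \<one>" using Q by (auto simp: elementary_abelian_def)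
  interpret comm_group Q by fact
  note lin = comm_group_Irr_linear[OF cQ \<mu>]
  have pow: "\<mu> (x [^] (n::nat)) = \<mu> x ^ n" if "x \<in> carrier Q" for x n
    using that by (induct n) (auto simp: lin)
  \<comment> \<open>The exponent p forces all values to be p-th roots of unity, of which there are
    at most p.\<close>
  have roots: "\<mu> ` carrier Q \<subseteq> {z. z ^ p = 1}" using pow[of _ p] exp lin(1) by force
  have fin: "finite {z::complex. z ^ p = 1}" using p by (intro finite_roots_unity) auto
  have "card {z::complex. z ^ p = 1} \<le> p" using p by (intro card_roots_unity) auto
  then have im: "card (\<mu> ` carrier Q) \<le> p" using card_mono[OF fin roots] by simp
  let ?K = "{x \<in> carrier Q. \<mu> x = 1}"
  \<comment> \<open>Multiplication by the inverse of one element of a fibre injects that fibre into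
    the kernel.\<close>
  have fibre: "card {x \<in> carrier Q. \<mu> x = c} \<le> card ?K" if "c \<in> \<mu> ` carrier Q" for c
  proof -
    obtain y where y: "y \<in> carrier Q" "c = \<mu> y" using \<open>c \<in> \<mu> ` carrier Q\<close> by auto
    have iy: "\<mu> (inv y) * \<mu> y = 1" using lin(1) lin(2)[of "inv y" y] y by simp
    show ?thesis
    proof (rule card_inj_on_le[of "\<lambda>x. inv y \<otimes> x"])
      show "inj_on (\<lambda>x. inv y \<otimes> x) {x \<in> carrier Q. \<mu> x = c}" using y by (auto intro!: inj_onI)
      show "(\<lambda>x. inv y \<otimes> x) ` {x \<in> carrier Q. \<mu> x = c} \<subseteq> ?K" using y lin(2) iy by auto
    qed (use Q in auto)
  qed
  have "carrier Q = (\<Union>c\<in>\<mu> ` carrier Q. {x \<in> carrier Q. \<mu> x = c})" by auto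
  then have "card (carrier Q) \<le> (\<Sum>c\<in>\<mu> ` carrier Q. card {x \<in> carrier Q. \<mu> x = c})"
    using card_UN_le[of "\<mu> ` carrier Q" "\<lambda>c. {x \<in> carrier Q. \<mu> x = c}"] Q(2) by simp
  also have "\<dots> \<le> (\<Sum>c\<in>\<mu> ` carrier Q. card ?K)" by (rule sum_mono) (use fibre in auto)
  also have "\<dots> \<le> p * card ?K" using im by simp
  finally show ?thesis .
qed

text \<open>The kernel of \<open>\<psi>\<close> has order at least p^(e+1), and on it
  \<open>\<psi>\<close> agrees with the trivial character.\<close>

lemma elementary_abelian_conn:
  assumes G: "group G" "finite (carrier G)" and p: "prime p" and Q: "subgroup Q G"
    and el: "elementary_abelian p (G\<lparr>carrier := Q\<rparr>)" "card Q = p ^ (e + 2)" and \<psi>: "\<psi> \<in> Irr (G\<lparr>carrier := Q\<rparr>)"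
  shows "poset_conn (Gamma_pe p e G) (Gamma_le G) (Q, \<psi>) (Q, restrict (\<lambda>_. 1) Q)"
proof -
  let ?Q = "G\<lparr>carrier := Q\<rparr>"
  have p1: "p > 1" using p by (rule prime_gt_1_nat)
  have gQ: "group ?Q" using group.subgroup_imp_group[OF G(1) Q] .
  have finQ: "finite Q" using subgroup.subset[OF Q] G(2) finite_subset by blast
  have cQ: "comm_group ?Q" using el by (simp add: elementary_abelian_def)
  let ?A = "{x \<in> Q. \<psi> x = 1}"
  have A: "subgroup ?A ?Q"
    using linear_kernel_subgroup[OF gQ comm_group_Irr_linear[OF cQ \<psi>]] by simp
  have "p ^ (e + 2) \<le> p * card ?A"
    using elementary_abelian_kernel_card[OF el(1) _ _ \<psi>] finQ el(2) p1 by simp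
  then have "p ^ (e + 1) \<le> card ?A" using p1 by simp
  moreover have "p ^ e < p ^ (e + 1)" using p1 by simp
  ultimately have big: "p ^ e < card ?A" by (rule less_le_trans[rotated])
  \<comment> \<open>Membership in \<open>Spe\<close> also demands that the order of the kernel be a
    power of p; Lagrange's theorem supplies this.\<close>
  have "card (rcosets\<^bsub>?Q\<^esub> ?A) * card ?A = card Q"
    using group.lagrange[OF gQ A] by (simp add: Coset.order_def)
  then have "card ?A dvd p ^ (e + 2)" unfolding el(2) by (metis dvd_triv_right)
  then have "\<exists>k. card ?A = p ^ k" using divides_primepow_nat[OF p] by blast
  then have AS: "?A \<in> Spe p e G" using big group.incl_subgroup[OF G(1) Q A] by (simp add: Spe_def)
  have QS: "Q \<in> Spe p e G" using Spe_powerI[OF p Q el(2)] by simp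
  show ?thesis
    by (rule Gamma_conn_of_agree[OF G QS AS _ \<psi>]) (use trivial_character_Irr[OF gQ] in auto)
qed

text \<open>With \<open>Q = A \<times> B\<close>, the linear character agreeing with \<open>\<psi>\<close> on \<open>A\<close> and trivial on \<open>B\<close> links
  \<open>\<psi>\<close> to the trivial character.\<close>

lemma product_cyclic_conn:
  assumes G: "group G" "finite (carrier G)" and p: "prime p" and Q: "subgroup Q G"
    and iso: "G\<lparr>carrier := Q\<rparr> \<cong> integer_mod_group (p ^ (e + 1)) \<times>\<times> integer_mod_group (p ^ (e + 1))"
    and \<psi>: "\<psi> \<in> Irr (G\<lparr>carrier := Q\<rparr>)"
  shows "Q \<in> Spe p e G \<and> poset_conn (Gamma_pe p e G) (Gamma_le G) (Q, \<psi>) (Q, restrict (\<lambda>_. 1) Q)"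
proof -
  let ?Q = "G\<lparr>carrier := Q\<rparr>"
  define n where "n = p ^ (e + 1)"
  have p1: "p > 1" using p by (rule prime_gt_1_nat)
  then have n0: "n > 0" by (simp add: n_def)
  let ?Z = "integer_mod_group n"
  have cZ: "carrier ?Z = {0..<int n}" using n0 by (simp add: carrier_integer_mod_group)
  interpret Q: group ?Q using group.subgroup_imp_group[OF G(1) Q] .
  have gQ: "group ?Q" by (rule Q.is_group)
  obtain f where f: "f \<in> iso ?Q (?Z \<times>\<times> ?Z)" using iso by (auto simp: is_iso_def n_def)
  have fh: "f \<in> hom ?Q (?Z \<times>\<times> ?Z)" and fb: "bij_betw f Q ({0..<int n} \<times> {0..<int n})"
    using f by (auto simp: iso_def cZ)
  have fmult: "f (x \<otimes>\<^bsub>G\<^esub> y) = ((fst (f x) + fst (f y)) mod int n, (snd (f x) + snd (f y)) mod int n)"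
    if "x \<in> Q" "y \<in> Q" for x y
    using hom_mult[OF fh] that by (simp add: mult_DirProd' case_prod_beta)
  have fin: "f x \<in> {0..<int n} \<times> {0..<int n}" if "x \<in> Q" for x using fb that by (auto simp: bij_betw_def)
  have finj: "x = y" if "f x = f y" "x \<in> Q" "y \<in> Q" for x y using fb that by (auto simp: bij_betw_def inj_on_def)
  have mclosed: "x \<otimes>\<^bsub>G\<^esub> y \<in> Q" if "x \<in> Q" "y \<in> Q" for x y using Q.m_closed that by simp
  \<comment> \<open>Commutativity is pulled back along the injective \<open>f\<close> from addition
    of residues.\<close>
  have cQ: "comm_group ?Q"
    by (rule Q.group_comm_groupI) (auto intro!: finj simp: fmult mclosed add.commute)
  note lin = comm_group_Irr_linear[OF cQ \<psi>, simplified]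
  have f1: "f \<one>\<^bsub>G\<^esub> = (0, 0)"
    using hom_one[OF fh gQ] by (simp add: DirProd_group)
  define h where "h = inv_into Q f"
  have hf: "h (f x) = x" if "x \<in> Q" for x using fb that by (simp add: h_def bij_betw_def)
  have hQ: "h z \<in> Q" "f (h z) = z" if "z \<in> {0..<int n} \<times> {0..<int n}" for z
    using fb that unfolding h_def bij_betw_def by (auto intro: inv_into_into f_inv_into_f)
  \<comment> \<open>The projection of \<open>Q\<close> onto its first factor followed by
    \<open>\<psi>\<close>.\<close>
  define \<mu> where "\<mu> = (\<lambda>x. \<psi> (h (fst (f x), 0)))"
  have \<mu>m: "\<mu> (x \<otimes>\<^bsub>G\<^esub> y) = \<mu> x * \<mu> y" if xy: "x \<in> Q" "y \<in> Q" for x y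
  proof -
    let ?x = "h (fst (f x), 0)" and ?y = "h (fst (f y), 0)"
    have m: "(fst (f x), 0) \<in> {0..<int n} \<times> {0..<int n}" "(fst (f y), 0) \<in> {0..<int n} \<times> {0..<int n}"
      using fin[OF xy(1)] fin[OF xy(2)] n0 by auto
    have "f (?x \<otimes>\<^bsub>G\<^esub> ?y) = ((fst (f x) + fst (f y)) mod int n, 0)"
      using fmult[OF hQ(1)[OF m(1)] hQ(1)[OF m(2)]] hQ(2)[OF m(1)] hQ(2)[OF m(2)] by simp
    then have "h ((fst (f x) + fst (f y)) mod int n, 0) = ?x \<otimes>\<^bsub>G\<^esub> ?y"
      using hf[OF mclosed[OF hQ(1)[OF m(1)] hQ(1)[OF m(2)]]] by simp
    then show ?thesis using lin(2)[OF hQ(1)[OF m(1)] hQ(1)[OF m(2)]] fmult[OF xy] by (simp add: \<mu>_def)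
  qed
  have h0: "h (0, 0) = \<one>\<^bsub>G\<^esub>" using hf[of "\<one>\<^bsub>G\<^esub>"] f1 Q.one_closed by simp
  have \<mu>1: "\<mu> \<one>\<^bsub>G\<^esub> = 1" using f1 h0 lin(1) by (simp add: \<mu>_def)
  have \<mu>I: "restrict \<mu> Q \<in> Irr ?Q"
    using linear_character_Irr[OF gQ, of \<mu>] \<mu>m \<mu>1 by simp
  \<comment> \<open>The zero set of \<open>snd\<close> is the first factor and that of
    \<open>fst\<close> is the second. Each has exactly n = p^(e+1) elements, just enough to exceed
    p^e.\<close>
  have sub: "{x \<in> Q. pr (f x) = 0} \<in> Spe p e G"
    if pr: "pr = fst \<or> pr = snd" for pr :: "int \<times> int \<Rightarrow> int"
  proof -
    have "pr \<circ> f \<in> hom ?Q ?Z"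
      using pr fin by (auto intro!: homI simp: fmult cZ mem_Times_iff)
    then interpret group_hom ?Q ?Z "pr \<circ> f"
      using gQ by (simp add: group_hom_def group_hom_axioms_def)
    have "subgroup {x \<in> Q. pr (f x) = 0} ?Q"
      using subgroup_kernel by (simp add: kernel_def)
    then have s: "subgroup {x \<in> Q. pr (f x) = 0} G" using group.incl_subgroup[OF G(1) Q] by simp
    let ?B = "{z \<in> {0..<int n} \<times> {0..<int n}. pr z = 0}"
    have "f ` {x \<in> Q. pr (f x) = 0} = {z \<in> f ` Q. pr z = 0}" by auto
    then have "bij_betw f {x \<in> Q. pr (f x) = 0} ?B"
      using fb unfolding bij_betw_def by (auto intro: inj_on_subset)
    then have "card {x \<in> Q. pr (f x) = 0} = card ?B" by (rule bij_betw_same_card)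
    also have "?B = (if pr = fst then {0} \<times> {0..<int n} else {0..<int n} \<times> {0})"
      using pr n0 by auto
    also have "card \<dots> = n" by simp
    finally have "card {x \<in> Q. pr (f x) = 0} = p ^ (e + 1)" by (simp only: n_def)
    then show ?thesis by (rule Spe_powerI[OF p s]) simp
  qed
  have "card Q = n * n" using bij_betw_same_card[OF fb] by simp
  then have "card Q = p ^ ((e + 1) + (e + 1))" by (simp only: n_def power_add)
  then have QS: "Q \<in> Spe p e G" by (rule Spe_powerI[OF p Q]) simp
  have "poset_conn (Gamma_pe p e G) (Gamma_le G) (Q, \<psi>) (Q, restrict \<mu> Q)"
  proof (rule Gamma_conn_of_agree[OF G QS sub[of snd] _ \<psi> \<mu>I])
    fix x assume x: "x \<in> {x \<in> Q. snd (f x) = 0}"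
    then have "(fst (f x), 0) = f x" by (simp add: prod_eq_iff)
    then show "\<psi> x = restrict \<mu> Q x" using x hf by (simp add: \<mu>_def)
  qed auto
  moreover have "poset_conn (Gamma_pe p e G) (Gamma_le G) (Q, restrict \<mu> Q) (Q, restrict (\<lambda>_. 1) Q)"
  proof (rule Gamma_conn_of_agree[OF G QS sub[of fst] _ \<mu>I])
    show "restrict (\<lambda>_. 1) Q \<in> Irr ?Q" using trivial_character_Irr[OF gQ] by simp
    fix x assume x: "x \<in> {x \<in> Q. fst (f x) = 0}"
    then show "restrict \<mu> Q x = restrict (\<lambda>_. 1) Q x" using h0 lin(1) by (simp add: \<mu>_def)
  qed auto
  ultimately show ?thesis using QS poset_conn_trans by metis
qed

lemma Gamma_connected:
  assumes G: "group G" "finite (carrier G)" and p: "prime p" "card (carrier G) = p ^ k" and Q: "subgroup Q G"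
    and "G\<lparr>carrier := Q\<rparr> \<cong> integer_mod_group (p ^ (e + 1)) \<times>\<times> integer_mod_group (p ^ (e + 1)) \<or>
         elementary_abelian p (G\<lparr>carrier := Q\<rparr>) \<and> card Q = p ^ (e + 2)"
  shows "Q \<in> Spe p e G" "poset_connected (Gamma_pe p e G) (Gamma_le G)"
proof -
  have gQ: "group (G\<lparr>carrier := Q\<rparr>)" using group.subgroup_imp_group[OF G(1) Q] .
  have triv: "restrict (\<lambda>_. 1) Q \<in> Irr (G\<lparr>carrier := Q\<rparr>)" using trivial_character_Irr[OF gQ] by simp
  have *: "Q \<in> Spe p e G \<and> poset_conn (Gamma_pe p e G) (Gamma_le G) (Q, \<psi>) (Q, restrict (\<lambda>_. 1) Q)"
    if \<psi>: "\<psi> \<in> Irr (G\<lparr>carrier := Q\<rparr>)" for \<psi>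
    using assms(6)
  proof
    assume "G\<lparr>carrier := Q\<rparr> \<cong> integer_mod_group (p ^ (e + 1)) \<times>\<times> integer_mod_group (p ^ (e + 1))"
    then show ?thesis by (rule product_cyclic_conn[OF G p(1) Q _ \<psi>])
  next
    assume e: "elementary_abelian p (G\<lparr>carrier := Q\<rparr>) \<and> card Q = p ^ (e + 2)"
    then have "Q \<in> Spe p e G" using Spe_powerI[OF p(1) Q, of "e + 2"] by simp
    then show ?thesis using elementary_abelian_conn[OF G p(1) Q _ _ \<psi>] e by simp
  qed
  show QS: "Q \<in> Spe p e G" using *[OF triv] by simp
  show "poset_connected (Gamma_pe p e G) (Gamma_le G)"
    using Gamma_connected_of_conn[OF G p(2) QS triv] * by blast
qed

theorem theorem1:
  fixes G :: "('a, 'm) monoid_scheme" and P :: "'a set" and p e :: nat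
  assumes "group G" and "finite (carrier G)" and "prime p" and "sylow_subgroup p G P"
  shows
    "card (pi0 (Gamma_pe p e G) (Gamma_le G))
       = card (pi0 (X_pe p e G P) (Gamma_le G)) * card (pi0 (Spe p e G) (\<subseteq>)) \<and>
     card (pi0 (X_pe p e G P) (Gamma_le G)) * card (pi0 (Spe p e G) (\<subseteq>))
       \<le> card (pi0 (Gamma_pe p e (G\<lparr>carrier := P\<rparr>)) (Gamma_le (G\<lparr>carrier := P\<rparr>)))
           * card (pi0 (Spe p e G) (\<subseteq>)) \<and>
     ((\<exists>Q. subgroup Q (G\<lparr>carrier := P\<rparr>) \<and>
          (G\<lparr>carrier := Q\<rparr> \<cong> integer_mod_group (p ^ (e + 1)) \<times>\<times> integer_mod_group (p ^ (e + 1)) \<or>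
           elementary_abelian p (G\<lparr>carrier := Q\<rparr>) \<and> card Q = p ^ (e + 2))) \<longrightarrow>
      poset_connected (Gamma_pe p e (G\<lparr>carrier := P\<rparr>)) (Gamma_le (G\<lparr>carrier := P\<rparr>)) \<and>
      card (pi0 (Gamma_pe p e G) (Gamma_le G)) = card (pi0 (Spe p e G) (\<subseteq>)) \<and>
      card (pi0 (Spe p e G) (\<subseteq>)) = card (rcosets\<^bsub>G\<^esub> (comp_stabilizer p e G P)))"
proof -
  interpret finite_group_sylow G P p e
    using assms by (simp add: finite_group_sylow_def finite_group_sylow_axioms_def)
  let ?P = "G\<lparr>carrier := P\<rparr>"
  let ?X = "pi0 (X_pe p e G P) (Gamma_le G)"
  have special: "poset_connected (Gamma_pe p e ?P) (Gamma_le ?P) \<and> card (pi0 \<Gamma> (Gamma_le G)) = card (pi0 \<S> (\<subseteq>)) \<and>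
      card (pi0 \<S> (\<subseteq>)) = card (rcosets\<^bsub>G\<^esub> (comp_stabilizer p e G P))"
    if Q: "subgroup Q ?P" and cases: "G\<lparr>carrier := Q\<rparr> \<cong> integer_mod_group (p ^ (e + 1)) \<times>\<times> integer_mod_group (p ^ (e + 1)) \<or>
           elementary_abelian p (G\<lparr>carrier := Q\<rparr>) \<and> card Q = p ^ (e + 2)" for Q
  proof -
    have gP: "group ?P" and fP: "finite (carrier ?P)" and cP': "card (carrier ?P) = p ^ multiplicity p (card (carrier G))"
      using subgroup_imp_group[OF sP] finite_subset[OF Pc fin] cP by auto
    have conn: "Q \<in> Spe p e ?P" "poset_connected (Gamma_pe p e ?P) (Gamma_le ?P)"
      using Gamma_connected[OF gP fP prime cP' Q] cases by simp_all
    \<comment> \<open>\<open>Q\<close> passes the size bound, so \<open>P\<close> does too; the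
      index formula requires this.\<close>
    then have PS: "P \<in> \<S>" using Spe_sylow(1) Spe_sylow_subset by blast
    have "card (pi0 (Gamma_pe p e ?P) (Gamma_le ?P)) = 1"
      using conn(2) unfolding poset_connected_def by (metis is_singletonI' is_singleton_altdef empty_iff)
    then have "card ?X \<le> 1" using pi0_X_le by simp
    moreover have "(P, restrict (\<lambda>_. 1) P) \<in> X_pe p e G P"
      using PS trivial_character_Irr[OF gP] by (simp add: X_pe_def Gamma_pe_def poset_conn_refl)
    \<comment> \<open>The trivial character of \<open>P\<close> gives a point of X(P). Together with
      finiteness this rules out cardinality 0.\<close>
    then have "?X \<noteq> {}" by (auto simp: pi0_def)
    then have "card ?X > 0" using pi0_X_le by (simp add: card_gt_0_iff)
    ultimately have "card ?X = 1" by simp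
    then show ?thesis using conn(2) card_pi0_Gamma card_pi0_Spe[OF PS] by simp
  qed
  show ?thesis using card_pi0_Gamma pi0_X_le special by (auto intro!: mult_le_mono1)
qed

end
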